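(* Suppose that $\sup_{t\in T}\mathrm{E}\left[l^2(\xi-t)\right]<+\infty$ and that there exists a random variable $K(\xi)$ with $\mathrm{E}[K(\xi)^2]<\infty$ such that $|l(\xi-t_1)-l(\xi-t_2)|\le K(\xi)|t_1-t_2|$ for all $t_1,t_2\in T$ and a.e. $\xi$. Then, as $n\to\infty$, $$\sqrt{n}\,(v_n-v^* )\Rightarrow \inf_{t\in S=[t_l,t_u]}Y(t).$$ If, moreover, $S$ is a singleton $\{t^*\}$, then $$\sqrt{n}\,(v_n-v^* )\Rightarrow N(0,\sigma^2(t^* )).$$
   Context: Let $u$ be a proper closed concave nondecreasing utility function with $u(0)=0$ and $1\in\partial u(0)$ (subdifferential), and let $l(z)=-u(-z)$ (so $l$ is proper, closed, convex and nondecreasing). Let $\xi$ be a real random variable (the random loss) and $T\subset\mathbb{R}$ a compact interval. The OCE (optimized certainty equivalent) risk measure of the loss $\xi$ is the optimal value of $$\min_{t\in T}\ t+\mathrm{E}[l(\xi-t)].$$ Let $v^*$ and $S$ denote the optimal value and the set of optimal solutions; $S$ is a compact interval, written $S=[t_l,t_u]$. Let $\xi_1,\xi_2,\ldots$ be i.i.d. copies of $\xi$, and let $v_n$ be the optimal value of the sample average approximation $$\min_{t\in T}\ t+\frac1n\sum_{i=1}^n l(\xi_i-t).$$ Let $\sigma^2(t)=\mathrm{Var}[l(\xi-t)]$. $Y$ is the limit in distribution, as a random element of $C(T)$, of $$\sqrt{n}\left[\left(t+\frac1n\sum_{i=1}^n l(\xi_i-t)\right)-\left(t+\mathrm{E}[l(\xi-t)]\right)\right],\quad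 t\in T,$$ that is, the mean-zero Gaussian process on $T$ with covariance function $\mathrm{Cov}(l(\xi-s),l(\xi-t))$; in particular $Y(t)\sim N(0,\sigma^2(t))$ for each $t$. The symbol $\Rightarrow$ denotes convergence in distribution. *)

theory Defs
  imports "HOL-Probability.Probability"
begin

section \<open>Extended-valued utility functions and the associated loss\<close>

text \<open>A concave function may take the value \<open>-\<infinity>\<close>, so that it has type \<open>real \<Rightarrow> ereal\<close>;
  concavity and closedness are convexity and closedness of the hypograph.\<close>

definition hypograph :: "(real \<Rightarrow> ereal) \<Rightarrow> (real \<times> real) set"
  where "hypograph u = {(x, r). ereal r \<le> u x}"

definition proper_concave :: "(real \<Rightarrow> ereal) \<Rightarrow> bool"
  where "proper_concave u \<longleftrightarrow>
    convex (hypograph u) \<and> (\<forall>x. u x < \<infinity>) \<and> (\<exists>x. - \<infinity> < u x)"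

definition concave_subdifferential :: "(real \<Rightarrow> ereal) \<Rightarrow> real \<Rightarrow> real set"
  where "concave_subdifferential u x = {g. \<forall>y. u y \<le> u x + ereal (g * (y - x))}"

definition utility :: "(real \<Rightarrow> ereal) \<Rightarrow> bool"
  where "utility u \<longleftrightarrow>
    proper_concave u \<and> closed (hypograph u) \<and> mono u \<and>
    u 0 = 0 \<and> 1 \<in> concave_subdifferential u 0"

definition loss_of :: "(real \<Rightarrow> ereal) \<Rightarrow> real \<Rightarrow> ereal"
  where "loss_of u z = - u (- z)"


section \<open>The optimized certainty equivalent and its sample average approximation\<close>

text \<open>\<open>E[f\<^sup>+] - E[f\<^sup>-]\<close>; note that \<open>e2ennreal\<close> truncates negative values to \<open>0\<close>, and that
  \<open>\<infinity> - \<infinity> = \<infinity>\<close> in \<open>ereal\<close>.\<close>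

definition ereal_expectation :: "'b measure \<Rightarrow> ('b \<Rightarrow> ereal) \<Rightarrow> ereal"
  where "ereal_expectation P f =
    enn2ereal (\<integral>\<^sup>+ \<omega>. e2ennreal (f \<omega>) \<partial>P) - enn2ereal (\<integral>\<^sup>+ \<omega>. e2ennreal (- f \<omega>) \<partial>P)"

definition oce_objective :: "(real \<Rightarrow> ereal) \<Rightarrow> 'b measure \<Rightarrow> ('b \<Rightarrow> real) \<Rightarrow> real \<Rightarrow> ereal"
  where "oce_objective l P \<xi> t = ereal t + ereal_expectation P (\<lambda>\<omega>. l (\<xi> \<omega> - t))"

definition oce_value :: "(real \<Rightarrow> ereal) \<Rightarrow> 'b measure \<Rightarrow> ('b \<Rightarrow> real) \<Rightarrow> real set \<Rightarrow> ereal"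
  where "oce_value l P \<xi> T = (INF t\<in>T. oce_objective l P \<xi> t)"

definition oce_solutions :: "(real \<Rightarrow> ereal) \<Rightarrow> 'b measure \<Rightarrow> ('b \<Rightarrow> real) \<Rightarrow> real set \<Rightarrow> real set"
  where "oce_solutions l P \<xi> T = {t \<in> T. oce_objective l P \<xi> t = oce_value l P \<xi> T}"

definition saa_objective :: "(real \<Rightarrow> ereal) \<Rightarrow> nat \<Rightarrow> (nat \<Rightarrow> real) \<Rightarrow> real \<Rightarrow> ereal"
  where "saa_objective l n x t = ereal t + ereal (1 / real n) * (\<Sum>i<n. l (x i - t))"

definition saa_value :: "(real \<Rightarrow> ereal) \<Rightarrow> nat \<Rightarrow> (nat \<Rightarrow> real) \<Rightarrow> real set \<Rightarrow> ereal"
  where "saa_value l n x T = (INF t\<in>T. saa_objective l n x t)"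


section \<open>Normal laws and Gaussian processes\<close>

definition covariance :: "'b measure \<Rightarrow> ('b \<Rightarrow> real) \<Rightarrow> ('b \<Rightarrow> real) \<Rightarrow> real"
  where "covariance P f g =
    (\<integral>\<omega>. (f \<omega> - (\<integral>\<omega>'. f \<omega>' \<partial>P)) * (g \<omega> - (\<integral>\<omega>'. g \<omega>' \<partial>P)) \<partial>P)"

text \<open>For square-integrable losses \<open>l (\<xi> - t)\<close> is almost surely finite, so that passing to \<open>real\<close>
  does not affect second moments.\<close>

definition loss_covariance ::
    "(real \<Rightarrow> ereal) \<Rightarrow> 'b measure \<Rightarrow> ('b \<Rightarrow> real) \<Rightarrow> real \<Rightarrow> real \<Rightarrow> real"
  where "loss_covariance l P \<xi> s t =
    covariance P (\<lambda>\<omega>. real_of_ereal (l (\<xi> \<omega> - s))) (\<lambda>\<omega>. real_of_ereal (l (\<xi> \<omega> - t)))"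

definition loss_variance :: "(real \<Rightarrow> ereal) \<Rightarrow> 'b measure \<Rightarrow> ('b \<Rightarrow> real) \<Rightarrow> real \<Rightarrow> real"
  where "loss_variance l P \<xi> t = prob_space.variance P (\<lambda>\<omega>. real_of_ereal (l (\<xi> \<omega> - t)))"

text \<open>The law \<open>N(m, v)\<close> with variance \<open>v \<ge> 0\<close>; \<open>v = 0\<close> gives the point mass at \<open>m\<close>.\<close>

definition normal_law :: "real \<Rightarrow> real \<Rightarrow> real measure"
  where "normal_law m v = distr std_normal_distribution borel (\<lambda>z. m + sqrt v * z)"

text \<open>A random element of \<open>C(T)\<close> is a process with continuous paths on \<open>T\<close>; it is Gaussian if
  all finite linear combinations of its values are normal.\<close>

definition centered_gaussian_process ::
    "'c measure \<Rightarrow> real set \<Rightarrow> (real \<Rightarrow> real \<Rightarrow> real) \<Rightarrow> (real \<Rightarrow> 'c \<Rightarrow> real) \<Rightarrow> bool"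
  where "centered_gaussian_process N T C Y \<longleftrightarrow>
    prob_space N \<and>
    (\<forall>t\<in>T. Y t \<in> borel_measurable N) \<and>
    (\<forall>\<omega>\<in>space N. continuous_on T (\<lambda>t. Y t \<omega>)) \<and>
    (\<forall>F c. finite F \<and> F \<subseteq> T \<longrightarrow>
      (\<exists>m v. 0 \<le> v \<and> distr N borel (\<lambda>\<omega>. \<Sum>t\<in>F. c t * Y t \<omega>) = normal_law m v)) \<and>
    (\<forall>t\<in>T. (\<integral>\<omega>. Y t \<omega> \<partial>N) = 0) \<and>
    (\<forall>s\<in>T. \<forall>t\<in>T. covariance N (Y s) (Y t) = C s t)"

end

theory Submission
  imports Defs
begin

text \<open>Write \<open>f t = t + E[l (\<xi> - t)]\<close> for the objective, \<open>v\<close> for its minimum on \<open>[a, b]\<close>, and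
  \<open>G n t\<close> for the normalized deviation of the sample average of \<open>l (\<xi> - t)\<close> from its mean. The
  sample average objective is \<open>f t + G n t / sqrt n\<close>, so that the scaled gap equals
  \<open>inf\<^sub>t (sqrt n * (f t - v) + G n t)\<close>. The first term vanishes on the solution set \<open>S\<close> and tends to
  infinity uniformly at a positive distance from \<open>S\<close>. If \<open>G n\<close> does not oscillate much over short
  distances, the gap is therefore close to the minimum of \<open>G n\<close> over a fine finite net \<open>F\<close> of \<open>S\<close>,
  and the joint central limit theorem on \<open>F\<close> yields the limit \<open>min\<^sub>F Y\<close>, which is close to
  \<open>inf\<^sub>S Y\<close> by continuity of the paths of \<open>Y\<close>. The whole argument is carried out with expectations
  of bounded Lipschitz test functions. Three estimates carry it.

  \<^item> Modulus of continuity (\<open>G_modulus\<close>). Over a grid of mesh \<open>d\<close>, Cauchy-Schwarz bounds every squared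
    increment of a path by its length times the energy
    \<open>(\<Sum> squared increments over neighbouring grid points) / d\<close>. The Lipschitz hypothesis makes the
    second moment of each increment of \<open>G n\<close> at most \<open>E[K\<^sup>2] d\<^sup>2\<close>, so that the expected energy is
    at most \<open>(b - a) E[K\<^sup>2]\<close> for every mesh and every \<open>n\<close>. Fatou's lemma passes to mesh \<open>0\<close> and gives
    \<open>(G n s - G n t)\<^sup>2 \<le> \<bar>s - t\<bar> W\<close> with \<open>E[W]\<close> bounded independently of \<open>n\<close>. This replaces tightness in \<open>C(T)\<close>.

  \<^item> Joint convergence on finite sets (\<open>Cramer_Wold_Lipschitz\<close>). The central limit theorem for linear
    combinations gives convergence of the expectations of all trigonometric polynomials of
    \<open>(G n t)\<^sub>t\<^sub>\<in>\<^sub>F\<close>. A Lipschitz function of \<open>R sin (x / R)\<close> is a uniform limit of such polynomials by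
    Stone-Weierstrass, and since \<open>\<bar>x - R sin (x / R)\<bar> \<le> x\<^sup>2 / R\<close>, bounded second moments control
    the error of replacing \<open>x\<close> by \<open>R sin (x / R)\<close>.

  \<^item> Comparison of the gap with a finite minimum (\<open>scaled_gap_near_finite_minimum\<close>). It is a
    deterministic consequence of the modulus and of the separation of \<open>f\<close> from \<open>v\<close> off \<open>S\<close>.

  On the side of the loss, monotonicity and \<open>l z \<ge> z\<close> make \<open>l (\<xi> - t)\<close> finite for all \<open>t\<close> in \<open>[a, b]\<close>
  at once, almost surely. Monotonicity also reduces the infimum over \<open>[a, b]\<close> to a countable one, which
  makes the sample value measurable, and makes the Lipschitz bound hold simultaneously for all pairs
  \<open>s\<close>, \<open>t\<close> outside one null set. Convexity of \<open>f\<close> makes \<open>S\<close> an interval. If \<open>S\<close> is a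
  singleton, the net is that singleton and the one-dimensional central limit theorem suffices.\<close>

section \<open>Joint convergence from convergence of linear combinations\<close>

lemma open_coordinate_preimage:
  assumes "open W" shows "open {h :: 'a \<Rightarrow> 'b::topological_space. h i \<in> W}"
  using open_vimage[OF assms continuous_on_product_coordinates[of i]] by (simp add: vimage_def)

text \<open>Distinct functions differ in some coordinate, and separating sets in that coordinate pull back to
  the product. The Hausdorff property of products over an arbitrary index type is what
  Stone-Weierstrass needs on a cube of functions; the two weaker separation axioms are its
  superclasses.\<close>

instance "fun" :: (type, t0_space) t0_space
proof
  fix f g :: "'a \<Rightarrow> 'b" assume "f \<noteq> g"
  then obtain i where "f i \<noteq> g i" by blast
  then obtain U where "open U" "\<not> (f i \<in> U \<longleftrightarrow> g i \<in> U)"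
    using t0_space_class.t0_space by metis
  then show "\<exists>U. open U \<and> \<not> (f \<in> U \<longleftrightarrow> g \<in> U)"
    by (intro exI[of _ "{h. h i \<in> U}"]) (auto intro: open_coordinate_preimage)
qed

instance "fun" :: (type, t1_space) t1_space
proof
  fix f g :: "'a \<Rightarrow> 'b" assume "f \<noteq> g"
  then obtain i where "f i \<noteq> g i" by blast
  then obtain U where "open U" "f i \<in> U" "g i \<notin> U"
    using t1_space_class.t1_space by metis
  then show "\<exists>U. open U \<and> f \<in> U \<and> g \<notin> U"
    by (intro exI[of _ "{h. h i \<in> U}"]) (auto intro: open_coordinate_preimage)
qed

instance "fun" :: (type, t2_space) t2_space
proof
  fix f g :: "'a \<Rightarrow> 'b" assume "f \<noteq> g"
  then obtain i where "f i \<noteq> g i" by blast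
  then obtain U V where UV: "open U" "open V" "f i \<in> U" "g i \<in> V" "U \<inter> V = {}"
    using hausdorff by metis
  show "\<exists>U V. open U \<and> open V \<and> f \<in> U \<and> g \<in> V \<and> U \<inter> V = {}"
    using UV by (intro exI[of _ "{h. h i \<in> U}"] exI[of _ "{h. h i \<in> V}"])
      (auto intro: open_coordinate_preimage)
qed

lemma compact_PiE:
  fixes S :: "'i \<Rightarrow> 'b::topological_space set"
  assumes "\<And>i. i \<in> I \<Longrightarrow> compact (S i)"
  shows "compact (PiE I S)"
proof -
  have eq: "PiE I S = PiE UNIV (\<lambda>i. if i \<in> I then S i else {undefined})"
    by (fastforce simp: PiE_def extensional_def Pi_def split: if_splits)
  have "compactin (product_topology (\<lambda>i. euclidean) UNIV) (PiE I S)"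
    unfolding eq by (subst compactin_PiE) (use assms in auto)
  then show ?thesis by (simp add: euclidean_product_topology)
qed

text \<open>Real linear combinations of waves in the coordinates from \<open>F\<close>. The phase \<open>d\<close> turns sines into
  shifted cosines, so that a single generator is enough.\<close>

inductive_set trig_polys :: "'i set \<Rightarrow> (('i \<Rightarrow> real) \<Rightarrow> real) set" for F where
  cosine: "(\<lambda>x. r * cos ((\<Sum>t\<in>F. c t * x t) + d)) \<in> trig_polys F"
| add: "f \<in> trig_polys F \<Longrightarrow> g \<in> trig_polys F \<Longrightarrow> (\<lambda>x. f x + g x) \<in> trig_polys F"

lemma trig_polys_const: "(\<lambda>x. r) \<in> trig_polys F"
  using trig_polys.cosine[of r "\<lambda>_. 0" F 0] by simp

lemma trig_polys_sin_coordinate: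
  assumes "finite F" "t \<in> F"
  shows "(\<lambda>x. sin (r * x t)) \<in> trig_polys F"
proof -
  have *: "(\<Sum>s\<in>F. (if s = t then r else 0) * x s) = r * x t" for x :: "'a \<Rightarrow> real"
    using assms by (simp add: if_distrib[of "\<lambda>z. z * _"] cong: if_cong)
  show ?thesis
    using trig_polys.cosine[of 1 "\<lambda>s. if s = t then r else 0" F "- (pi / 2)"]
    by (simp only: *) (simp add: cos_sin_eq add.commute cos_diff)
qed

text \<open>By the product formula \<open>2 cos p cos q = cos (p - q) + cos (p + q)\<close>.\<close>

lemma trig_polys_mult:
  assumes "f \<in> trig_polys F" "g \<in> trig_polys F"
  shows "(\<lambda>x. f x * g x) \<in> trig_polys F"
  using assms(1)
proof induction
  case f: (cosine r c d)
  show ?case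
    using assms(2)
  proof induction
    case (cosine r' c' d')
    have "(\<lambda>x. r * cos ((\<Sum>t\<in>F. c t * x t) + d) * (r' * cos ((\<Sum>t\<in>F. c' t * x t) + d')))
      = (\<lambda>x. r * r' / 2 * cos ((\<Sum>t\<in>F. (c t - c' t) * x t) + (d - d'))
           + r * r' / 2 * cos ((\<Sum>t\<in>F. (c t + c' t) * x t) + (d + d')))"
    proof
      fix x :: "'a \<Rightarrow> real"
      let ?a = "(\<Sum>t\<in>F. c t * x t) + d" and ?b = "(\<Sum>t\<in>F. c' t * x t) + d'"
      have "(\<Sum>t\<in>F. (c t - c' t) * x t) + (d - d') = ?a - ?b"
           "(\<Sum>t\<in>F. (c t + c' t) * x t) + (d + d') = ?a + ?b"
        by (simp_all add: algebra_simps sum.distrib sum_subtractf)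
      then show "r * cos ?a * (r' * cos ?b) = r * r' / 2 * cos ((\<Sum>t\<in>F. (c t - c' t) * x t) + (d - d'))
           + r * r' / 2 * cos ((\<Sum>t\<in>F. (c t + c' t) * x t) + (d + d'))"
        by (simp only: cos_add cos_diff) (simp add: algebra_simps)
    qed
    then show ?case by (simp only:) (intro trig_polys.intros)
  next
    case (add g h)
    then show ?case by (simp add: distrib_left trig_polys.add)
  qed
next
  case (add f h)
  then show ?case by (simp add: distrib_right trig_polys.add)
qed

lemma trig_polys_bounded: "f \<in> trig_polys F \<Longrightarrow> \<exists>B. \<forall>x. \<bar>f x\<bar> \<le> B"
proof (induction rule: trig_polys.induct)
  case (cosine r c d)
  have "\<bar>r * cos z\<bar> \<le> \<bar>r\<bar>" for z :: real
    using mult_left_mono[OF abs_cos_le_one[of z], of "\<bar>r\<bar>"] by (simp add: abs_mult)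
  then show ?case by blast
next
  case (add f g)
  then obtain B C where "\<And>x. \<bar>f x\<bar> \<le> B" "\<And>x. \<bar>g x\<bar> \<le> C" by blast
  then have "\<bar>f x + g x\<bar> \<le> B + C" for x
    by (meson abs_triangle_ineq add_mono order_trans)
  then show ?case by blast
qed

lemma trig_polys_measurable:
  assumes "f \<in> trig_polys F" "\<And>t. t \<in> F \<Longrightarrow> A t \<in> borel_measurable M"
  shows "(\<lambda>\<omega>. f (\<lambda>t. A t \<omega>)) \<in> borel_measurable M"
  using assms(1)
proof induction
  case (cosine r c d)
  have "(\<lambda>\<omega>. \<Sum>t\<in>F. c t * A t \<omega>) \<in> borel_measurable M"
    using assms(2) by (intro borel_measurable_sum) simp
  then show ?case by simp
qed simp

lemma (in prob_space) trig_polys_integrable: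
  assumes "f \<in> trig_polys F" "\<And>t. t \<in> F \<Longrightarrow> A t \<in> borel_measurable M"
  shows "integrable M (\<lambda>\<omega>. f (\<lambda>t. A t \<omega>))"
proof -
  obtain B where "\<And>x. \<bar>f x\<bar> \<le> B" using trig_polys_bounded[OF assms(1)] by blast
  then show ?thesis
    by (intro integrable_const_bound[of _ B]) (use trig_polys_measurable[OF assms] in auto)
qed

lemma trig_polys_integral_convergence:
  assumes M: "prob_space M" and N: "prob_space N"
    and A: "\<And>n t. t \<in> F \<Longrightarrow> A n t \<in> borel_measurable M"
    and B: "\<And>t. t \<in> F \<Longrightarrow> B t \<in> borel_measurable N"
    and conv: "\<And>c d. (\<lambda>n. \<integral>\<omega>. cos ((\<Sum>t\<in>F. c t * A n t \<omega>) + d) \<partial>M)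
      \<longlonglongrightarrow> (\<integral>\<omega>. cos ((\<Sum>t\<in>F. c t * B t \<omega>) + d) \<partial>N)"
    and f: "f \<in> trig_polys F"
  shows "(\<lambda>n. \<integral>\<omega>. f (\<lambda>t. A n t \<omega>) \<partial>M) \<longlonglongrightarrow> (\<integral>\<omega>. f (\<lambda>t. B t \<omega>) \<partial>N)"
  using f
proof induction
  case (cosine r c d)
  show ?case using tendsto_mult_left[OF conv[of c d], of r] by simp
next
  case (add f g)
  have "integrable M (\<lambda>\<omega>. h (\<lambda>t. A n t \<omega>))" if "h \<in> trig_polys F" for h n
    by (rule prob_space.trig_polys_integrable[OF M that]) (rule A)
  moreover have "integrable N (\<lambda>\<omega>. h (\<lambda>t. B t \<omega>))" if "h \<in> trig_polys F" for h
    by (rule prob_space.trig_polys_integrable[OF N that]) (rule B)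
  ultimately show ?case using tendsto_add[OF add.IH] add.hyps by simp
qed

lemma abs_diff_sin_le_square: "\<bar>x - sin x\<bar> \<le> (x::real)\<^sup>2"
proof -
  have "(\<Sum>m<2. sin_coeff m * x ^ m) = x"
    by (simp add: numeral_2_eq_2 sin_coeff_def)
  then have "\<bar>sin x - x\<bar> \<le> \<bar>x\<bar>\<^sup>2 / 2"
    using Maclaurin_sin_bound[of x 2] by (simp add: fact_2)
  then show ?thesis using zero_le_power2[of x] unfolding power2_abs by linarith
qed

lemma abs_diff_scaled_sin_le:
  assumes "R > 0" shows "\<bar>x - R * sin (x / R)\<bar> \<le> (x::real)\<^sup>2 / R"
proof -
  have "x - R * sin (x / R) = R * (x / R - sin (x / R))"
    using assms by (simp add: right_diff_distrib)
  then have "\<bar>x - R * sin (x / R)\<bar> = R * \<bar>x / R - sin (x / R)\<bar>"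
    using assms by (simp add: abs_mult)
  also have "\<dots> \<le> R * (x / R)\<^sup>2"
    using assms by (intro mult_left_mono abs_diff_sin_le_square) auto
  finally show ?thesis using assms by (simp add: power2_eq_square)
qed

text \<open>In the variables \<open>y t = sin (x t / R)\<close>, which range over a compact cube, the functions of \<open>y\<close> whose
  pull-back to \<open>x\<close> is a trigonometric polynomial form an algebra containing the coordinates. Hence
  Stone-Weierstrass approximates \<open>y \<mapsto> g (R y)\<close> on the cube, and thus \<open>x \<mapsto> g (R sin (x / R))\<close> on the
  whole space. Approximating \<open>g\<close> itself on a large cube would leave the polynomial uncontrolled outside.\<close>

lemma Lipschitz_scaled_sine_approximation:
  fixes g :: "('i \<Rightarrow> real) \<Rightarrow> real"
  assumes F: "finite F" and e: "e > 0" and R: "R > 0"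
    and lip: "\<And>x y. \<bar>g x - g y\<bar> \<le> L * (\<Sum>t\<in>F. \<bar>x t - y t\<bar>)"
  shows "\<exists>f\<in>trig_polys F. \<forall>x. \<bar>g (\<lambda>t. R * sin (x t / R)) - f x\<bar> < e"
proof -
  define S :: "('i \<Rightarrow> real) set" where "S = PiE F (\<lambda>_. {-1..1})"
  define P where "P p \<longleftrightarrow> continuous_on S p \<and>
     (\<lambda>x. p (\<lambda>t\<in>F. sin (x t / R))) \<in> trig_polys F" for p :: "('i \<Rightarrow> real) \<Rightarrow> real"
  have coord: "continuous_on S (\<lambda>x. x t)" for t :: 'i
    by (rule continuous_on_subset[OF continuous_on_product_coordinates[of t]]) simp
  have cont: "continuous_on S (\<lambda>y. g (\<lambda>t. R * y t))"
    unfolding continuous_on_def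
  proof
    fix y assume "y \<in> S"
    have "continuous_on S (\<lambda>z. L * (\<Sum>t\<in>F. \<bar>R * z t - R * y t\<bar>))"
      by (intro continuous_on_mult_left continuous_on_sum continuous_on_rabs continuous_on_diff continuous_on_const coord)
    then have "((\<lambda>z. L * (\<Sum>t\<in>F. \<bar>R * z t - R * y t\<bar>)) \<longlongrightarrow> L * (\<Sum>t\<in>F. \<bar>R * y t - R * y t\<bar>)) (at y within S)"
      using \<open>y \<in> S\<close> unfolding continuous_on_def by blast
    then have lim: "((\<lambda>z. L * (\<Sum>t\<in>F. \<bar>R * z t - R * y t\<bar>)) \<longlongrightarrow> 0) (at y within S)" by simp
    have "\<forall>\<^sub>F z in at y within S. norm (g (\<lambda>t. R * z t) - g (\<lambda>t. R * y t)) \<le> L * (\<Sum>t\<in>F. \<bar>R * z t - R * y t\<bar>)"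
      using lip by (intro always_eventually) auto
    then have "((\<lambda>z. g (\<lambda>t. R * z t) - g (\<lambda>t. R * y t)) \<longlongrightarrow> 0) (at y within S)"
      using lim by (rule Lim_null_comparison)
    then show "((\<lambda>z. g (\<lambda>t. R * z t)) \<longlongrightarrow> g (\<lambda>t. R * y t)) (at y within S)"
      by (rule LIM_zero_cancel)
  qed
  have "\<exists>p. P p \<and> (\<forall>x\<in>S. \<bar>g (\<lambda>t. R * x t) - p x\<bar> < e)"
  proof (rule Stone_Weierstrass_HOL[where S = S])
    show "compact S" unfolding S_def by (intro compact_PiE) auto
    show "P (\<lambda>x. c)" for c by (simp add: P_def trig_polys_const)
    show "P f \<Longrightarrow> continuous_on S f" for f by (simp add: P_def)
    show "P f \<and> P h \<Longrightarrow> P (\<lambda>x. f x + h x)" for f h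
      unfolding P_def by (simp add: continuous_on_add trig_polys.add)
    show "P f \<and> P h \<Longrightarrow> P (\<lambda>x. f x * h x)" for f h
      unfolding P_def by (simp add: continuous_on_mult trig_polys_mult)
    show "\<exists>f. P f \<and> f x \<noteq> f y" if xy: "x \<in> S \<and> y \<in> S \<and> x \<noteq> y" for x y
    proof -
      obtain t where t: "t \<in> F" "x t \<noteq> y t"
        using xy unfolding S_def by (metis PiE_ext)
      have "P (\<lambda>z. z t)"
        unfolding P_def using coord trig_polys_sin_coordinate[OF F t(1), of "1 / R"] t(1)
        by simp
      then show ?thesis using t(2) by blast
    qed
  qed (fact cont, fact e)
  then obtain p where p: "P p" "\<And>x. x \<in> S \<Longrightarrow> \<bar>g (\<lambda>t. R * x t) - p x\<bar> < e" by blast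
  show ?thesis
  proof (intro bexI[of _ "\<lambda>x. p (\<lambda>t\<in>F. sin (x t / R))"] allI)
    fix x :: "'i \<Rightarrow> real"
    let ?y = "\<lambda>t\<in>F. sin (x t / R)"
    have "?y \<in> S" by (auto simp: S_def)
    have "g (\<lambda>t. R * ?y t) = g (\<lambda>t. R * sin (x t / R))"
      using lip[of "\<lambda>t. R * ?y t" "\<lambda>t. R * sin (x t / R)"] by simp
    then show "\<bar>g (\<lambda>t. R * sin (x t / R)) - p ?y\<bar> < e" using p(2)[OF \<open>?y \<in> S\<close>] by simp
  qed (use p(1) in \<open>simp add: P_def\<close>)
qed

text \<open>The replacement of \<open>x\<close> by \<open>R sin (x / R)\<close> moves each coordinate by at most \<open>x\<^sup>2 / R\<close>, so that second
  moments bound its effect on the expectation.\<close>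

lemma (in prob_space) integral_sine_truncation_le:
  assumes F: "finite F" and R: "R > 0" and "0 \<le> L"
    and lip: "\<And>x y. \<bar>g x - g y\<bar> \<le> L * (\<Sum>t\<in>F. \<bar>x t - y t\<bar>)"
    and meas: "(\<lambda>\<omega>. g (\<lambda>t. A t \<omega>)) \<in> borel_measurable M" and bdd: "\<And>x. \<bar>g x\<bar> \<le> C"
    and A: "\<And>t. t \<in> F \<Longrightarrow> A t \<in> borel_measurable M"
    and sq: "\<And>t. t \<in> F \<Longrightarrow> integrable M (\<lambda>\<omega>. (A t \<omega>)\<^sup>2)"
    and V: "(\<Sum>t\<in>F. \<integral>\<omega>. (A t \<omega>)\<^sup>2 \<partial>M) \<le> V"
    and f: "f \<in> trig_polys F" "\<And>x. \<bar>g (\<lambda>t. R * sin (x t / R)) - f x\<bar> \<le> e"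
  shows "\<bar>(\<integral>\<omega>. g (\<lambda>t. A t \<omega>) \<partial>M) - (\<integral>\<omega>. f (\<lambda>t. A t \<omega>) \<partial>M)\<bar> \<le> e + L * V / R"
proof -
  have ig: "integrable M (\<lambda>\<omega>. g (\<lambda>t. A t \<omega>))"
    by (intro integrable_const_bound[of _ C]) (use bdd meas in auto)
  have i_f: "integrable M (\<lambda>\<omega>. f (\<lambda>t. A t \<omega>))"
    by (rule trig_polys_integrable[OF f(1) A])
  have isq: "integrable M (\<lambda>\<omega>. e + L / R * (\<Sum>t\<in>F. (A t \<omega>)\<^sup>2))"
    using sq by auto
  have pt: "\<bar>g x - f x\<bar> \<le> e + L / R * (\<Sum>t\<in>F. (x t)\<^sup>2)" for x
  proof -
    have "\<bar>g x - g (\<lambda>t. R * sin (x t / R))\<bar> \<le> L * (\<Sum>t\<in>F. \<bar>x t - R * sin (x t / R)\<bar>)"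
      using lip[of x "\<lambda>t. R * sin (x t / R)"] .
    also have "\<dots> \<le> L * (\<Sum>t\<in>F. (x t)\<^sup>2 / R)"
      using \<open>0 \<le> L\<close> by (intro mult_left_mono sum_mono abs_diff_scaled_sin_le R)
    also have "\<dots> = L / R * (\<Sum>t\<in>F. (x t)\<^sup>2)"
      by (simp add: sum_divide_distrib[symmetric])
    finally show ?thesis using f(2)[of x] by linarith
  qed
  have "\<bar>(\<integral>\<omega>. g (\<lambda>t. A t \<omega>) \<partial>M) - (\<integral>\<omega>. f (\<lambda>t. A t \<omega>) \<partial>M)\<bar>
      = \<bar>\<integral>\<omega>. g (\<lambda>t. A t \<omega>) - f (\<lambda>t. A t \<omega>) \<partial>M\<bar>"
    using ig i_f by simp
  also have "\<dots> \<le> (\<integral>\<omega>. \<bar>g (\<lambda>t. A t \<omega>) - f (\<lambda>t. A t \<omega>)\<bar> \<partial>M)"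
    by (rule integral_abs_bound)
  also have "\<dots> \<le> (\<integral>\<omega>. e + L / R * (\<Sum>t\<in>F. (A t \<omega>)\<^sup>2) \<partial>M)"
    using ig i_f isq pt by (intro integral_mono) auto
  also have "\<dots> = e + L / R * (\<Sum>t\<in>F. \<integral>\<omega>. (A t \<omega>)\<^sup>2 \<partial>M)"
    using sq by (simp add: prob_space)
  also have "\<dots> \<le> e + L / R * V"
    using V \<open>0 \<le> L\<close> R by (intro add_left_mono mult_left_mono) auto
  finally show ?thesis by simp
qed

text \<open>First choose \<open>R\<close> so large that the truncation error is small for all \<open>n\<close>, then a trigonometric
  polynomial for this \<open>R\<close>, and only then \<open>n\<close>.\<close>

lemma Cramer_Wold_Lipschitz:
  fixes g :: "('i \<Rightarrow> real) \<Rightarrow> real"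
  assumes M: "prob_space M" and N: "prob_space N" and F: "finite F"
    and A: "\<And>n t. t \<in> F \<Longrightarrow> A n t \<in> borel_measurable M"
    and B: "\<And>t. t \<in> F \<Longrightarrow> B t \<in> borel_measurable N"
    and A2: "\<And>n t. t \<in> F \<Longrightarrow> integrable M (\<lambda>\<omega>. (A n t \<omega>)\<^sup>2)"
    and B2: "\<And>t. t \<in> F \<Longrightarrow> integrable N (\<lambda>\<omega>. (B t \<omega>)\<^sup>2)"
    and V: "\<And>n t. t \<in> F \<Longrightarrow> (\<integral>\<omega>. (A n t \<omega>)\<^sup>2 \<partial>M) \<le> V t"
    and conv: "\<And>c d. (\<lambda>n. \<integral>\<omega>. cos ((\<Sum>t\<in>F. c t * A n t \<omega>) + d) \<partial>M)
      \<longlonglongrightarrow> (\<integral>\<omega>. cos ((\<Sum>t\<in>F. c t * B t \<omega>) + d) \<partial>N)"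
    and lip: "0 \<le> L" "\<And>x y. \<bar>g x - g y\<bar> \<le> L * (\<Sum>t\<in>F. \<bar>x t - y t\<bar>)"
    and bdd: "\<And>x. \<bar>g x\<bar> \<le> C"
    and gA: "\<And>n. (\<lambda>\<omega>. g (\<lambda>t. A n t \<omega>)) \<in> borel_measurable M"
    and gB: "(\<lambda>\<omega>. g (\<lambda>t. B t \<omega>)) \<in> borel_measurable N"
  shows "(\<lambda>n. \<integral>\<omega>. g (\<lambda>t. A n t \<omega>) \<partial>M) \<longlonglongrightarrow> (\<integral>\<omega>. g (\<lambda>t. B t \<omega>) \<partial>N)"
proof (rule LIMSEQ_I)
  fix r :: real assume r: "0 < r"
  define W where "W = max (\<Sum>t\<in>F. V t) (\<Sum>t\<in>F. \<integral>\<omega>. (B t \<omega>)\<^sup>2 \<partial>N)"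
  \<comment> \<open>This value makes the truncation error \<open>L * W / R\<close> at most \<open>r / 8\<close>, uniformly in \<open>n\<close>.\<close>
  define R where "R = 8 * (L * \<bar>W\<bar> + 1) / r"
  have R: "R > 0" unfolding R_def using r lip(1)
    by (intro divide_pos_pos mult_pos_pos) (auto intro: add_nonneg_pos)
  have "L * W / R \<le> (L * \<bar>W\<bar> + 1) / R"
    using R lip(1) mult_left_mono[OF abs_ge_self[of W] lip(1)]
    by (intro divide_right_mono) linarith+
  also have "\<dots> = r / 8"
  proof -
    have "L * \<bar>W\<bar> + 1 > 0" using lip(1) by (intro add_nonneg_pos) auto
    moreover have "z / (8 * z / r) = r / 8" if "z > 0" for z using that r by simp
    ultimately show ?thesis unfolding R_def by blast
  qed
  finally have small: "L * W / R \<le> r / 8" .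
  obtain f where f: "f \<in> trig_polys F" "\<And>x. \<bar>g (\<lambda>t. R * sin (x t / R)) - f x\<bar> < r / 8"
    using Lipschitz_scaled_sine_approximation[OF F _ R lip(2), of "r / 8"] r by auto
  have fle: "\<bar>g (\<lambda>t. R * sin (x t / R)) - f x\<bar> \<le> r / 8" for x using f(2)[of x] by simp
  have 1: "\<bar>(\<integral>\<omega>. g (\<lambda>t. A n t \<omega>) \<partial>M) - (\<integral>\<omega>. f (\<lambda>t. A n t \<omega>) \<partial>M)\<bar> \<le> r / 8 + r / 8" for n
  proof -
    have "(\<Sum>t\<in>F. \<integral>\<omega>. (A n t \<omega>)\<^sup>2 \<partial>M) \<le> W"
      unfolding W_def using V by (intro max.coboundedI1 sum_mono)
    with prob_space.integral_sine_truncation_le[where g = g and A = "A n" and f = f, OF M F R lip gA bdd]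
    have "\<bar>(\<integral>\<omega>. g (\<lambda>t. A n t \<omega>) \<partial>M) - (\<integral>\<omega>. f (\<lambda>t. A n t \<omega>) \<partial>M)\<bar> \<le> r / 8 + L * W / R"
      using A A2 f(1) fle by blast
    then show ?thesis using small by linarith
  qed
  have "(\<Sum>t\<in>F. \<integral>\<omega>. (B t \<omega>)\<^sup>2 \<partial>N) \<le> W" unfolding W_def by simp
  with prob_space.integral_sine_truncation_le[where g = g and A = B and f = f, OF N F R lip gB bdd]
  have "\<bar>(\<integral>\<omega>. g (\<lambda>t. B t \<omega>) \<partial>N) - (\<integral>\<omega>. f (\<lambda>t. B t \<omega>) \<partial>N)\<bar> \<le> r / 8 + L * W / R"
    using B B2 f(1) fle by blast
  then have 2: "\<bar>(\<integral>\<omega>. g (\<lambda>t. B t \<omega>) \<partial>N) - (\<integral>\<omega>. f (\<lambda>t. B t \<omega>) \<partial>N)\<bar> \<le> r / 8 + r / 8"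
    using small by linarith
  have "(\<lambda>n. \<integral>\<omega>. f (\<lambda>t. A n t \<omega>) \<partial>M) \<longlonglongrightarrow> (\<integral>\<omega>. f (\<lambda>t. B t \<omega>) \<partial>N)"
    by (rule trig_polys_integral_convergence[where A = A and B = B, OF M N A B conv f(1)])
  from LIMSEQ_D[OF this, of "r / 2"] r obtain n0 where
    n0: "\<And>n. n \<ge> n0 \<Longrightarrow> \<bar>(\<integral>\<omega>. f (\<lambda>t. A n t \<omega>) \<partial>M) - (\<integral>\<omega>. f (\<lambda>t. B t \<omega>) \<partial>N)\<bar> < r / 2"
    by auto
  have "\<bar>(\<integral>\<omega>. g (\<lambda>t. A n t \<omega>) \<partial>M) - (\<integral>\<omega>. g (\<lambda>t. B t \<omega>) \<partial>N)\<bar> < r" if "n \<ge> n0" for n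
    using n0[OF that] 1[of n] 2 by linarith
  then show "\<exists>n0. \<forall>n\<ge>n0. norm ((\<integral>\<omega>. g (\<lambda>t. A n t \<omega>) \<partial>M) - (\<integral>\<omega>. g (\<lambda>t. B t \<omega>) \<partial>N)) < r"
    by auto
qed

section \<open>Normal laws and normalized sums of an i.i.d. sample\<close>

lemma integral_normal_law:
  fixes f :: "real \<Rightarrow> real"
  assumes "f \<in> borel_measurable borel"
  shows "(\<integral>x. f x \<partial>normal_law m v) = (\<integral>z. f (m + sqrt v * z) \<partial>std_normal_distribution)"
  unfolding normal_law_def using assms by (subst integral_distr) auto

lemma real_distribution_normal_law: "real_distribution (normal_law m v)"
proof -
  interpret real_distribution std_normal_distribution by (rule real_dist_normal_dist)
  show ?thesis unfolding normal_law_def by (rule real_distribution_distr) simp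
qed

lemma integral_std_normal_identity: "(\<integral>z. z \<partial>std_normal_distribution) = 0"
  using integral_std_normal_distribution_moment_odd[of 1] by simp

lemma integral_std_normal_square: "(\<integral>z. z\<^sup>2 \<partial>std_normal_distribution) = 1"
  using std_normal_distribution_even_moments(1)[of 1] by (simp add: fact_2)

lemma integrable_normal_law_square: "integrable (normal_law m v) (\<lambda>x. x\<^sup>2)"
proof -
  interpret real_distribution std_normal_distribution by (rule real_dist_normal_dist)
  have "integrable std_normal_distribution (\<lambda>z. m\<^sup>2 + 2 * m * s * z ^ 1 + s\<^sup>2 * z\<^sup>2)" for s
    using integrable_std_normal_distribution_moment[of 1] integrable_std_normal_distribution_moment[of 2]
    by (intro Bochner_Integration.integrable_add integrable_mult_right integrable_const) auto
  moreover have "m\<^sup>2 + 2 * m * s * z ^ 1 + s\<^sup>2 * z\<^sup>2 = (m + s * z)\<^sup>2" for s z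
    by (simp add: power2_eq_square algebra_simps)
  ultimately have "integrable std_normal_distribution (\<lambda>z. (m + sqrt v * z)\<^sup>2)" by simp
  then show ?thesis unfolding normal_law_def by (subst integrable_distr_eq) auto
qed

lemma mean_normal_law: "(\<integral>x. x \<partial>normal_law m v) = m"
proof -
  interpret real_distribution std_normal_distribution by (rule real_dist_normal_dist)
  have i: "integrable std_normal_distribution (\<lambda>z. z)"
    using integrable_std_normal_distribution_moment[of 1] by simp
  have "(\<integral>x. x \<partial>normal_law m v) = (\<integral>z. m + sqrt v * z \<partial>std_normal_distribution)"
    by (rule integral_normal_law) simp
  also have "\<dots> = (\<integral>z. m \<partial>std_normal_distribution) + (\<integral>z. sqrt v * z \<partial>std_normal_distribution)"
    by (intro Bochner_Integration.integral_add integrable_mult_right i integrable_const)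
  also have "(\<integral>z. sqrt v * z \<partial>std_normal_distribution) = sqrt v * 0"
    unfolding integral_mult_right_zero integral_std_normal_identity ..
  also have "(\<integral>z. m \<partial>std_normal_distribution) = m"
    unfolding lebesgue_integral_const prob_space by simp
  finally show ?thesis by simp
qed

lemma second_moment_centered_normal_law: "0 \<le> v \<Longrightarrow> (\<integral>x. x\<^sup>2 \<partial>normal_law 0 v) = v"
proof -
  assume v: "0 \<le> v"
  have "(\<integral>x. x\<^sup>2 \<partial>normal_law 0 v) = (\<integral>z. (0 + sqrt v * z)\<^sup>2 \<partial>std_normal_distribution)"
    by (rule integral_normal_law) simp
  also have "\<dots> = (\<integral>z. v * z\<^sup>2 \<partial>std_normal_distribution)"
    using v by (simp only: add_0 power_mult_distrib real_sqrt_pow2)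
  also have "\<dots> = v * 1"
    unfolding integral_mult_right_zero integral_std_normal_square ..
  finally show ?thesis by simp
qed

lemma integrable_mult_if_square_integrable:
  fixes f g :: "'b \<Rightarrow> real"
  assumes [measurable]: "f \<in> borel_measurable M" "g \<in> borel_measurable M"
    and "integrable M (\<lambda>x. (f x)\<^sup>2)" "integrable M (\<lambda>x. (g x)\<^sup>2)"
  shows "integrable M (\<lambda>x. f x * g x)"
proof (rule Bochner_Integration.integrable_bound)
  show "integrable M (\<lambda>x. (f x)\<^sup>2 + (g x)\<^sup>2)" using assms by simp
  \<comment> \<open>The arithmetic-geometric mean inequality, with a factor two to spare.\<close>
  have "\<bar>a * b\<bar> \<le> a\<^sup>2 + b\<^sup>2" for a b :: real
  proof -
    have "2 * \<bar>a * b\<bar> \<le> a\<^sup>2 + b\<^sup>2"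
      using sum_squares_bound[of "\<bar>a\<bar>" "\<bar>b\<bar>"] by (simp add: abs_mult mult.assoc)
    then show ?thesis by linarith
  qed
  then show "AE x in M. norm (f x * g x) \<le> norm ((f x)\<^sup>2 + (g x)\<^sup>2)" by simp
qed simp

lemma integrable_square_sum:
  fixes f :: "'i \<Rightarrow> 'b \<Rightarrow> real"
  assumes "finite I" and "\<And>i. i \<in> I \<Longrightarrow> f i \<in> borel_measurable M"
    and "\<And>i. i \<in> I \<Longrightarrow> integrable M (\<lambda>x. (f i x)\<^sup>2)"
  shows "integrable M (\<lambda>x. (\<Sum>i\<in>I. f i x)\<^sup>2)"
  unfolding power2_eq_square sum_product
  by (intro Bochner_Integration.integrable_sum integrable_mult_if_square_integrable assms)

lemma integral_square_linear_combination:
  fixes f :: "'i \<Rightarrow> 'b \<Rightarrow> real"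
  assumes meas: "\<And>i. i \<in> I \<Longrightarrow> f i \<in> borel_measurable M"
    and sq: "\<And>i. i \<in> I \<Longrightarrow> integrable M (\<lambda>x. (f i x)\<^sup>2)"
  shows "(\<integral>x. (\<Sum>i\<in>I. c i * f i x)\<^sup>2 \<partial>M) = (\<Sum>i\<in>I. \<Sum>j\<in>I. c i * c j * (\<integral>x. f i x * f j x \<partial>M))"
proof -
  have int: "integrable M (\<lambda>x. f i x * f j x)" if "i \<in> I" "j \<in> I" for i j
    by (intro integrable_mult_if_square_integrable meas sq that)
  have "(\<Sum>i\<in>I. c i * f i x)\<^sup>2 = (\<Sum>i\<in>I. \<Sum>j\<in>I. c i * c j * (f i x * f j x))" for x
    unfolding power2_eq_square sum_product by (intro sum.cong refl) (simp add: ac_simps)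
  then have "(\<integral>x. (\<Sum>i\<in>I. c i * f i x)\<^sup>2 \<partial>M) = (\<integral>x. (\<Sum>i\<in>I. \<Sum>j\<in>I. c i * c j * (f i x * f j x)) \<partial>M)"
    by simp
  also have "\<dots> = (\<Sum>i\<in>I. \<integral>x. (\<Sum>j\<in>I. c i * c j * (f i x * f j x)) \<partial>M)"
    using int by (intro Bochner_Integration.integral_sum) auto
  also have "\<dots> = (\<Sum>i\<in>I. \<Sum>j\<in>I. \<integral>x. c i * c j * (f i x * f j x) \<partial>M)"
  proof (rule sum.cong[OF refl])
    fix i assume "i \<in> I"
    then show "(\<integral>x. (\<Sum>j\<in>I. c i * c j * (f i x * f j x)) \<partial>M) = (\<Sum>j\<in>I. \<integral>x. c i * c j * (f i x * f j x) \<partial>M)"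
      using int by (intro Bochner_Integration.integral_sum) auto
  qed
  finally show ?thesis by simp
qed

text \<open>The i.i.d. sample \<open>X\<close> is described through its common law \<open>\<mu>\<close> on the real line, which makes integrals
  of functions of one observation independent of the probability space of the sample.\<close>

locale iid_sample = prob_space M for M :: "'a measure" +
  fixes X :: "nat \<Rightarrow> 'a \<Rightarrow> real" and \<mu> :: "real measure"
  assumes indep: "indep_vars (\<lambda>_. borel) X UNIV"
    and law: "\<And>i. distr M borel (X i) = \<mu>"
begin

lemma X_measurable [measurable]: "X i \<in> borel_measurable M"
  using indep unfolding indep_vars_def2 by simp

sublocale \<mu>: real_distribution \<mu>
  by (subst law[symmetric, of 0], rule real_distribution_distr) simp

lemma integral_sample:
  fixes w :: "real \<Rightarrow> real"
  assumes "w \<in> borel_measurable borel"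
  shows "(\<integral>\<omega>. w (X i \<omega>) \<partial>M) = (\<integral>x. w x \<partial>\<mu>)"
  using integral_distr[OF X_measurable[of i] assms] by (simp add: law)

lemma integrable_sample:
  fixes w :: "real \<Rightarrow> real"
  assumes "w \<in> borel_measurable borel"
  shows "integrable M (\<lambda>\<omega>. w (X i \<omega>)) \<longleftrightarrow> integrable \<mu> w"
  using integrable_distr_eq[OF X_measurable[of i] assms] by (simp add: law)

lemma AE_sample:
  assumes "AE x in \<mu>. Q x" shows "AE \<omega> in M. \<forall>i. Q (X i \<omega>)"
  unfolding AE_all_countable
proof
  fix i
  have "AE x in distr M borel (X i). Q x" using assms by (subst law)
  then show "AE \<omega> in M. Q (X i \<omega>)" by (rule AE_distrD[OF X_measurable])
qed

definition normalized_sum :: "(real \<Rightarrow> real) \<Rightarrow> nat \<Rightarrow> 'a \<Rightarrow> real"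
  where "normalized_sum w n \<omega> = (\<Sum>i<n. w (X i \<omega>)) / sqrt (real n)"

lemma normalized_sum_measurable [measurable]:
  assumes [measurable]: "w \<in> borel_measurable borel"
  shows "normalized_sum w n \<in> borel_measurable M"
  unfolding normalized_sum_def by measurable

lemma second_moment_sum:
  assumes w [measurable]: "w \<in> borel_measurable borel"
    and sq: "integrable \<mu> (\<lambda>x. (w x)\<^sup>2)" and mean: "(\<integral>x. w x \<partial>\<mu>) = 0"
  shows "(\<integral>\<omega>. (\<Sum>i<n. w (X i \<omega>))\<^sup>2 \<partial>M) = n * (\<integral>x. (w x)\<^sup>2 \<partial>\<mu>)"
proof (induction n)
  case (Suc n)
  let ?S = "\<lambda>\<omega>. \<Sum>i<n. w (X i \<omega>)" and ?w = "\<lambda>\<omega>. w (X n \<omega>)"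
  have "indep_vars (\<lambda>_. borel) (\<lambda>i \<omega>. w (X i \<omega>)) UNIV"
    by (rule indep_vars_compose2[OF indep]) simp
  then have "indep_vars (\<lambda>_. borel) (\<lambda>i \<omega>. w (X i \<omega>)) (insert n {..<n})"
    by (rule indep_vars_subset) simp
  then have ind: "indep_var borel ?w borel ?S"
    by (intro indep_vars_sum) auto
  have iw: "integrable \<mu> w"
    by (rule \<mu>.square_integrable_imp_integrable[OF _ sq]) simp
  have sqX: "integrable M (\<lambda>\<omega>. (w (X i \<omega>))\<^sup>2)" for i
    using sq by (subst integrable_sample[of "\<lambda>x. (w x)\<^sup>2"]) auto
  have iX: "integrable M (\<lambda>\<omega>. w (X i \<omega>))" for i
    using iw by (subst integrable_sample) auto
  have iS: "integrable M ?S" using iX by auto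
  have iS2: "integrable M (\<lambda>\<omega>. (?S \<omega>)\<^sup>2)"
    by (rule integrable_square_sum) (use sqX in auto)
  have i_wS: "integrable M (\<lambda>\<omega>. ?w \<omega> * ?S \<omega>)"
    by (rule indep_var_integrable[OF ind iX iS])
  have "(\<integral>\<omega>. ?w \<omega> * ?S \<omega> \<partial>M) = 0"
    using indep_var_lebesgue_integral[OF ind iX iS] integral_sample[OF w] mean by simp
  moreover have "(\<Sum>i<Suc n. w (X i \<omega>))\<^sup>2 = (?S \<omega>)\<^sup>2 + 2 * (?w \<omega> * ?S \<omega>) + (?w \<omega>)\<^sup>2" for \<omega>
    by (simp add: power2_sum algebra_simps)
  ultimately have "(\<integral>\<omega>. (\<Sum>i<Suc n. w (X i \<omega>))\<^sup>2 \<partial>M)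
      = (\<integral>\<omega>. (?S \<omega>)\<^sup>2 \<partial>M) + (\<integral>\<omega>. (?w \<omega>)\<^sup>2 \<partial>M)"
    using iS2 i_wS sqX by simp
  then show ?case
    using Suc.IH integral_sample[of "\<lambda>x. (w x)\<^sup>2" n] by (simp add: distrib_right)
qed simp

lemma integrable_square_normalized_sum:
  assumes [measurable]: "w \<in> borel_measurable borel"
    and sq: "integrable \<mu> (\<lambda>x. (w x)\<^sup>2)"
  shows "integrable M (\<lambda>\<omega>. (normalized_sum w n \<omega>)\<^sup>2)"
proof -
  have "integrable M (\<lambda>\<omega>. (w (X i \<omega>))\<^sup>2)" for i
    using sq by (subst integrable_sample[of "\<lambda>x. (w x)\<^sup>2"]) auto
  then have "integrable M (\<lambda>\<omega>. (\<Sum>i<n. w (X i \<omega>))\<^sup>2)"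
    by (intro integrable_square_sum) auto
  then show ?thesis unfolding normalized_sum_def power_divide by simp
qed

lemma second_moment_normalized_sum:
  assumes [measurable]: "w \<in> borel_measurable borel"
    and sq: "integrable \<mu> (\<lambda>x. (w x)\<^sup>2)" and mean: "(\<integral>x. w x \<partial>\<mu>) = 0"
  shows "(\<integral>\<omega>. (normalized_sum w n \<omega>)\<^sup>2 \<partial>M) \<le> (\<integral>x. (w x)\<^sup>2 \<partial>\<mu>)"
  unfolding normalized_sum_def power_divide using second_moment_sum[OF assms, of n] by simp

text \<open>For positive variance this is the classical central limit theorem. For variance zero the summands
  vanish almost surely, and the normal law is the point mass at \<open>0\<close>.\<close>

lemma normalized_sum_CLT:
  fixes f :: "real \<Rightarrow> real"
  assumes [measurable]: "w \<in> borel_measurable borel"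
    and sq: "integrable \<mu> (\<lambda>x. (w x)\<^sup>2)" and mean: "(\<integral>x. w x \<partial>\<mu>) = 0"
    and cont: "\<And>x. isCont f x" and bdd: "\<And>x. \<bar>f x\<bar> \<le> B"
  shows "(\<lambda>n. \<integral>\<omega>. f (normalized_sum w n \<omega>) \<partial>M)
    \<longlonglongrightarrow> (\<integral>x. f x \<partial>normal_law 0 (\<integral>x. (w x)\<^sup>2 \<partial>\<mu>))"
proof -
  define v where "v = (\<integral>x. (w x)\<^sup>2 \<partial>\<mu>)"
  have [measurable]: "f \<in> borel_measurable borel"
    using cont by (intro borel_measurable_continuous_onI) (simp add: continuous_at_imp_continuous_on)
  have "v \<ge> 0" unfolding v_def by simp
  then consider "v = 0" | "v > 0" by linarith
  then have "(\<lambda>n. \<integral>\<omega>. f (normalized_sum w n \<omega>) \<partial>M)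
    \<longlonglongrightarrow> (\<integral>z. f (sqrt v * z) \<partial>std_normal_distribution)"
  proof cases
    case 1
    interpret std: real_distribution std_normal_distribution by (rule real_dist_normal_dist)
    have "AE x in \<mu>. w x = 0"
      using integral_nonneg_eq_0_iff_AE[OF sq] 1 unfolding v_def by simp
    then have "AE \<omega> in M. \<forall>i. w (X i \<omega>) = 0" by (rule AE_sample)
    then have "AE \<omega> in M. f (normalized_sum w n \<omega>) = f 0" for n
      by eventually_elim (simp add: normalized_sum_def)
    then have "(\<integral>\<omega>. f (normalized_sum w n \<omega>) \<partial>M) = (\<integral>\<omega>. f 0 \<partial>M)" for n
      by (intro integral_cong_AE) auto
    moreover have "(\<integral>z. f (sqrt v * z) \<partial>std_normal_distribution) = f 0"
      unfolding 1 real_sqrt_zero mult_zero_left lebesgue_integral_const std.prob_space by simp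
    ultimately show ?thesis by (simp add: prob_space)
  next
    case 2
    have "indep_vars (\<lambda>_. borel) (\<lambda>i \<omega>. w (X i \<omega>)) UNIV"
      by (rule indep_vars_compose2[OF indep]) simp
    moreover have m0: "expectation (\<lambda>\<omega>. w (X i \<omega>)) = 0" for i
      using mean integral_sample[of w] by simp
    moreover have "integrable M (\<lambda>\<omega>. (w (X i \<omega>))\<^sup>2)" for i
      using sq by (subst integrable_sample[of "\<lambda>x. (w x)\<^sup>2"]) auto
    moreover have "variance (\<lambda>\<omega>. w (X i \<omega>)) = (sqrt v)\<^sup>2" for i
      using m0 integral_sample[of "\<lambda>x. (w x)\<^sup>2" i] \<open>v \<ge> 0\<close> by (simp add: v_def)
    moreover have "distr M borel (\<lambda>\<omega>. w (X i \<omega>)) = distr \<mu> borel w" for i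
      using distr_distr[of w borel borel "X i" M] by (simp add: law comp_def)
    ultimately have wc: "weak_conv_m
        (\<lambda>n. distr M borel (\<lambda>\<omega>. (\<Sum>i<n. w (X i \<omega>)) / sqrt (n * (sqrt v)\<^sup>2))) std_normal_distribution"
      using 2 by (intro central_limit_theorem_zero_mean[where \<mu> = "distr \<mu> borel w"]) auto
    have "(\<lambda>n. \<integral>x. f (sqrt v * x) \<partial>distr M borel (\<lambda>\<omega>. (\<Sum>i<n. w (X i \<omega>)) / sqrt (n * (sqrt v)\<^sup>2)))
        \<longlonglongrightarrow> (\<integral>z. f (sqrt v * z) \<partial>std_normal_distribution)"
    proof (rule weak_conv_imp_integral_bdd_continuous_conv[OF _ real_dist_normal_dist wc])
      show "real_distribution (distr M borel (\<lambda>\<omega>. (\<Sum>i<n. w (X i \<omega>)) / sqrt (n * (sqrt v)\<^sup>2)))" for n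
        by (intro real_distribution_distr) measurable
      show "isCont (\<lambda>x. f (sqrt v * x)) x" for x
        by (intro isCont_o2[OF _ cont] continuous_intros)
      show "norm (f (sqrt v * x)) \<le> B" for x using bdd by simp
    qed
    moreover have "(\<integral>x. f (sqrt v * x) \<partial>distr M borel (\<lambda>\<omega>. (\<Sum>i<n. w (X i \<omega>)) / sqrt (n * (sqrt v)\<^sup>2)))
        = (\<integral>\<omega>. f (normalized_sum w n \<omega>) \<partial>M)" for n
    proof -
      have eq: "sqrt v * (s / sqrt (n * (sqrt v)\<^sup>2)) = s / sqrt n" for s :: real
        using 2 by (simp add: real_sqrt_mult)
      show ?thesis
        by (subst integral_distr, measurable) (simp only: eq normalized_sum_def)
    qed
    ultimately show ?thesis by simp
  qed
  moreover have "(\<integral>x. f x \<partial>normal_law 0 v) = (\<integral>z. f (sqrt v * z) \<partial>std_normal_distribution)"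
    by (subst integral_normal_law) auto
  ultimately show ?thesis unfolding v_def by simp
qed

end

section \<open>The modulus of continuity of the normalized process\<close>

lemma square_increment_le_sum_squares:
  fixes y :: "nat \<Rightarrow> real"
  assumes "i \<le> j" "j \<le> N"
  shows "(y j - y i)\<^sup>2 \<le> (\<Sum>k<N. (y (Suc k) - y k)\<^sup>2) * real (j - i)"
proof -
  have "(y j - y i)\<^sup>2 = (\<Sum>k\<in>{i..<j}. y (Suc k) - y k)\<^sup>2"
    using assms(1) by (simp add: sum_Suc_diff')
  also have "\<dots> \<le> (\<Sum>k\<in>{i..<j}. (y (Suc k) - y k)\<^sup>2) * real (j - i)"
    using sum_squared_le_sum_of_squares[of "\<lambda>k. y (Suc k) - y k" "{i..<j}"] by simp
  also have "\<dots> \<le> (\<Sum>k<N. (y (Suc k) - y k)\<^sup>2) * real (j - i)"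
    using assms by (intro mult_right_mono sum_mono2) auto
  finally show ?thesis .
qed

lemma continuous_on_if_Lipschitz:
  fixes g :: "real \<Rightarrow> real"
  assumes "\<And>s t. s \<in> S \<Longrightarrow> t \<in> S \<Longrightarrow> \<bar>g s - g t\<bar> \<le> L * \<bar>s - t\<bar>"
  shows "continuous_on S g"
proof -
  have "L * \<bar>s - t\<bar> \<le> \<bar>L\<bar> * \<bar>s - t\<bar>" for s t :: real by (intro mult_right_mono) auto
  then have "\<bar>L\<bar>-lipschitz_on S g"
    by (intro lipschitz_onI) (auto simp: dist_real_def intro!: order_trans[OF assms])
  then show ?thesis by (rule lipschitz_on_continuous_on)
qed

lemma isCont_if_Lipschitz:
  fixes g :: "real \<Rightarrow> real"
  assumes "\<And>s t. \<bar>g s - g t\<bar> \<le> L * \<bar>s - t\<bar>" shows "isCont g x"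
  using continuous_on_if_Lipschitz[of UNIV g L] assms by (simp add: continuous_on_eq_continuous_at)

lemma borel_measurable_if_Lipschitz:
  fixes g :: "real \<Rightarrow> real"
  assumes "\<And>s t. \<bar>g s - g t\<bar> \<le> L * \<bar>s - t\<bar>" shows "g \<in> borel_measurable borel"
  using continuous_on_if_Lipschitz[of UNIV g L] assms by (intro borel_measurable_continuous_onI) simp

text \<open>At \<open>N = 0\<close> every grid point equals \<open>a\<close>, since division by zero gives zero.\<close>

definition grid_point :: "real \<Rightarrow> real \<Rightarrow> nat \<Rightarrow> nat \<Rightarrow> real"
  where "grid_point a b N k = a + real k * (b - a) / real N"

lemma grid_point_in: "a \<le> b \<Longrightarrow> k \<le> N \<Longrightarrow> grid_point a b N k \<in> {a..b}"
proof (cases "N = 0")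
  case False
  assume "a \<le> b" "k \<le> N"
  then have "real k * (b - a) \<le> real N * (b - a)" by (intro mult_right_mono) auto
  with False have "real k * (b - a) / real N \<le> b - a" by (simp add: divide_le_eq mult.commute)
  moreover have "0 \<le> real k * (b - a) / real N" using \<open>a \<le> b\<close> by simp
  ultimately show ?thesis by (simp add: grid_point_def)
qed (simp add: grid_point_def)

lemma grid_point_floor_tendsto:
  assumes "a < b" "t \<in> {a..b}"
  shows "(\<lambda>N. grid_point a b N (nat \<lfloor>real N * ((t - a) / (b - a))\<rfloor>)) \<longlonglongrightarrow> t"
proof (rule tendsto_sandwich)
  define c where "c = (t - a) / (b - a)"
  have c: "c \<ge> 0" "c * (b - a) = t - a" using assms by (auto simp: c_def)
  have k: "real N * c - 1 \<le> real (nat \<lfloor>real N * c\<rfloor>)" "real (nat \<lfloor>real N * c\<rfloor>) \<le> real N * c" for N :: nat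
    using c(1) by (auto simp: of_nat_nat)
  have lo: "t - (b - a) / real N \<le> grid_point a b N (nat \<lfloor>real N * c\<rfloor>)"
    and hi: "grid_point a b N (nat \<lfloor>real N * c\<rfloor>) \<le> t" if "N > 0" for N :: nat
  proof -
    have "real (nat \<lfloor>real N * c\<rfloor>) * (b - a) / real N \<le> real N * c * (b - a) / real N"
      using k(2)[of N] assms by (intro divide_right_mono mult_right_mono) auto
    also have "\<dots> = t - a" using that c(2) by simp
    finally show "grid_point a b N (nat \<lfloor>real N * c\<rfloor>) \<le> t" by (simp add: grid_point_def)
    have "t - a - (b - a) / real N = (real N * c - 1) * (b - a) / real N"
      using that by (simp add: c(2)[symmetric] field_simps)
    also have "\<dots> \<le> real (nat \<lfloor>real N * c\<rfloor>) * (b - a) / real N"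
      using k(1)[of N] assms by (intro divide_right_mono mult_right_mono) auto
    finally show "t - (b - a) / real N \<le> grid_point a b N (nat \<lfloor>real N * c\<rfloor>)"
      by (simp add: grid_point_def)
  qed
  show "\<forall>\<^sub>F N in sequentially. t - (b - a) / real N \<le> grid_point a b N (nat \<lfloor>real N * ((t - a) / (b - a))\<rfloor>)"
    using eventually_gt_at_top[of 0] unfolding c_def[symmetric] by eventually_elim (rule lo)
  show "\<forall>\<^sub>F N in sequentially. grid_point a b N (nat \<lfloor>real N * ((t - a) / (b - a))\<rfloor>) \<le> t"
    using eventually_gt_at_top[of 0] unfolding c_def[symmetric] by eventually_elim (rule hi)
  have "(\<lambda>N. t - (b - a) / real N) \<longlonglongrightarrow> t - 0"
    by (intro tendsto_diff tendsto_const lim_const_over_n)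
  then show "(\<lambda>N. t - (b - a) / real N) \<longlonglongrightarrow> t" by simp
qed simp

text \<open>The Dirichlet energy, the integral of the squared slope, of the piecewise linear interpolation of \<open>g\<close> on the grid with \<open>N\<close> cells.\<close>

definition grid_energy :: "real \<Rightarrow> real \<Rightarrow> (real \<Rightarrow> real) \<Rightarrow> nat \<Rightarrow> real"
  where "grid_energy a b g N = real N / (b - a) *
    (\<Sum>k<N. (g (grid_point a b N (Suc k)) - g (grid_point a b N k))\<^sup>2)"

lemma grid_energy_nonneg: "a < b \<Longrightarrow> 0 \<le> grid_energy a b g N"
  unfolding grid_energy_def by (intro mult_nonneg_nonneg sum_nonneg) auto

lemma square_increment_le_grid_energy:
  assumes "a < b" "i \<le> j" "j \<le> N"
  shows "(g (grid_point a b N j) - g (grid_point a b N i))\<^sup>2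
    \<le> (grid_point a b N j - grid_point a b N i) * grid_energy a b g N"
proof (cases "N = 0")
  case False
  define E where "E = (\<Sum>k<N. (g (grid_point a b N (Suc k)) - g (grid_point a b N k))\<^sup>2)"
  have "(g (grid_point a b N j) - g (grid_point a b N i))\<^sup>2 \<le> E * real (j - i)"
    unfolding E_def using square_increment_le_sum_squares[OF assms(2,3), of "\<lambda>k. g (grid_point a b N k)"] .
  also have "E * real (j - i) = ((real j - real i) * (b - a) / real N) * (real N / (b - a) * E)"
    using False assms by (simp add: of_nat_diff)
  also have "\<dots> = (grid_point a b N j - grid_point a b N i) * grid_energy a b g N"
    unfolding grid_energy_def E_def grid_point_def by (simp add: diff_divide_distrib left_diff_distrib)
  finally show ?thesis .
qed (use assms in simp)

text \<open>Both endpoints are approximated by grid points, along a subsequence of grids on which the energy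
  tends to its lower limit.\<close>

lemma square_increment_le_liminf_grid_energy:
  assumes ab: "a < b" and g: "continuous_on {a..b} g" and st: "s \<in> {a..b}" "t \<in> {a..b}"
    and W: "liminf (\<lambda>N. ennreal (grid_energy a b g N)) = ennreal W" "0 \<le> W"
  shows "(g s - g t)\<^sup>2 \<le> \<bar>s - t\<bar> * W"
proof -
  have main: "(g t - g s)\<^sup>2 \<le> (t - s) * W" if st: "s \<in> {a..b}" "t \<in> {a..b}" "s \<le> t" for s t
  proof -
    define k where "k u N = nat \<lfloor>real N * ((u - a) / (b - a))\<rfloor>" for u :: real and N :: nat
    have k: "k s N \<le> k t N" "k t N \<le> N" for N
    proof -
      show "k s N \<le> k t N"
        unfolding k_def using st ab by (intro nat_mono floor_mono mult_left_mono divide_right_mono) auto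
      have "(t - a) / (b - a) \<le> 1" using st ab by simp
      then have "real N * ((t - a) / (b - a)) \<le> real N" by (intro mult_left_le) auto
      then show "k t N \<le> N" unfolding k_def by linarith
    qed
    obtain r where r: "strict_mono r" "(\<lambda>N. ennreal (grid_energy a b g (r N))) \<longlonglongrightarrow> ennreal W"
      using liminf_subseq_lim[of "\<lambda>N. ennreal (grid_energy a b g N)"] W(1) by (auto simp: comp_def)
    have eW: "(\<lambda>N. grid_energy a b g (r N)) \<longlonglongrightarrow> W"
      using r(2) W(2) by (subst (asm) tendsto_ennreal_iff) (auto intro: always_eventually grid_energy_nonneg[OF ab])
    have p: "(\<lambda>N. grid_point a b (r N) (k u (r N))) \<longlonglongrightarrow> u" if "u \<in> {a..b}" for u
      using LIMSEQ_subseq_LIMSEQ[OF grid_point_floor_tendsto[OF ab that] r(1)]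
      unfolding k_def by (simp add: comp_def)
    have gp: "(\<lambda>N. g (grid_point a b (r N) (k u (r N)))) \<longlonglongrightarrow> g u"
      if "u \<in> {a..b}" "\<And>N. k u N \<le> N" for u
    proof (rule continuous_on_tendsto_compose[OF g p[OF that(1)] that(1)])
      show "\<forall>\<^sub>F N in sequentially. grid_point a b (r N) (k u (r N)) \<in> {a..b}"
        using ab that(2) by (intro always_eventually allI grid_point_in) auto
    qed
    have ks: "k s N \<le> N" for N using k order_trans by blast
    show ?thesis
    proof (rule LIMSEQ_le)
      show "(\<lambda>N. (g (grid_point a b (r N) (k t (r N))) - g (grid_point a b (r N) (k s (r N))))\<^sup>2)
          \<longlonglongrightarrow> (g t - g s)\<^sup>2"
        by (intro tendsto_intros gp st k(2) ks)
      show "(\<lambda>N. (grid_point a b (r N) (k t (r N)) - grid_point a b (r N) (k s (r N))) *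
          grid_energy a b g (r N)) \<longlonglongrightarrow> (t - s) * W"
        by (intro tendsto_intros p st eW)
    qed (auto intro!: exI[of _ 0] square_increment_le_grid_energy[OF ab k])
  qed
  show ?thesis
    using main[of s t] main[of t s] st by (cases "s \<le> t") (auto simp: power2_commute)
qed

text \<open>The family \<open>h t\<close> takes the place of the losses \<open>x \<mapsto> l (x - t)\<close>. The Lipschitz bound holds
  for all pairs of parameters outside a single null set, which makes the paths of \<open>G n\<close> below
  continuous almost surely.\<close>

locale lipschitz_sample = iid_sample M X \<mu>
  for M :: "'a measure" and X \<mu> +
  fixes h :: "real \<Rightarrow> real \<Rightarrow> real" and K :: "real \<Rightarrow> real" and a b :: real
  assumes ab: "a \<le> b"
    and h_measurable: "\<And>t. t \<in> {a..b} \<Longrightarrow> h t \<in> borel_measurable borel"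
    and h_square: "\<And>t. t \<in> {a..b} \<Longrightarrow> integrable \<mu> (\<lambda>x. (h t x)\<^sup>2)"
    and K_measurable [measurable]: "K \<in> borel_measurable borel"
    and K_square: "integrable \<mu> (\<lambda>x. (K x)\<^sup>2)"
    and h_Lipschitz: "AE x in \<mu>. \<forall>s\<in>{a..b}. \<forall>t\<in>{a..b}. \<bar>h s x - h t x\<bar> \<le> K x * \<bar>s - t\<bar>"
begin

definition mean :: "real \<Rightarrow> real" where "mean t = (\<integral>x. h t x \<partial>\<mu>)"

definition centered :: "real \<Rightarrow> real \<Rightarrow> real" where "centered t x = h t x - mean t"

definition G :: "nat \<Rightarrow> real \<Rightarrow> 'a \<Rightarrow> real" where "G n t = normalized_sum (centered t) n"

lemma h_integrable: "t \<in> {a..b} \<Longrightarrow> integrable \<mu> (h t)"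
  by (rule \<mu>.square_integrable_imp_integrable[OF _ h_square]) (simp_all add: h_measurable)

lemma K_integrable: "integrable \<mu> K"
  by (rule \<mu>.square_integrable_imp_integrable[OF _ K_square]) simp

lemma centered_measurable: "t \<in> {a..b} \<Longrightarrow> centered t \<in> borel_measurable borel"
  using h_measurable[of t] unfolding centered_def[abs_def] by simp

lemma G_measurable: "t \<in> {a..b} \<Longrightarrow> G n t \<in> borel_measurable M"
  unfolding G_def by (intro normalized_sum_measurable centered_measurable)

lemma centered_integrable: "t \<in> {a..b} \<Longrightarrow> integrable \<mu> (centered t)"
  using h_integrable[of t] unfolding centered_def[abs_def] by simp

lemma centered_mean: "t \<in> {a..b} \<Longrightarrow> (\<integral>x. centered t x \<partial>\<mu>) = 0"
  using h_integrable[of t] \<mu>.prob_space unfolding centered_def by (simp add: mean_def)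

lemma centered_square:
  assumes "t \<in> {a..b}" shows "integrable \<mu> (\<lambda>x. (centered t x)\<^sup>2)"
  using h_integrable[OF assms] h_square[OF assms] unfolding centered_def power2_diff by simp

lemma mean_Lipschitz:
  assumes "s \<in> {a..b}" "t \<in> {a..b}"
  shows "\<bar>mean s - mean t\<bar> \<le> (\<integral>x. K x \<partial>\<mu>) * \<bar>s - t\<bar>"
proof -
  have "\<bar>mean s - mean t\<bar> = \<bar>\<integral>x. h s x - h t x \<partial>\<mu>\<bar>"
    unfolding mean_def using h_integrable assms by simp
  also have "\<dots> \<le> (\<integral>x. \<bar>h s x - h t x\<bar> \<partial>\<mu>)" by (rule integral_abs_bound)
  also have "\<dots> \<le> (\<integral>x. K x * \<bar>s - t\<bar> \<partial>\<mu>)"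
  proof (rule integral_mono_AE)
    show "AE x in \<mu>. \<bar>h s x - h t x\<bar> \<le> K x * \<bar>s - t\<bar>"
      using h_Lipschitz by eventually_elim (use assms in blast)
  qed (use h_integrable assms K_integrable in auto)
  finally show ?thesis by simp
qed

lemma mean_continuous: "continuous_on {a..b} mean"
  by (rule continuous_on_if_Lipschitz) (rule mean_Lipschitz)

lemma G_continuous: "AE \<omega> in M. \<forall>n. continuous_on {a..b} (\<lambda>t. G n t \<omega>)"
  using AE_sample[OF h_Lipschitz]
proof eventually_elim
  case (elim \<omega>)
  have "continuous_on {a..b} (\<lambda>t. h t (X i \<omega>))" for i
    by (rule continuous_on_if_Lipschitz[where L = "K (X i \<omega>)"]) (use elim in blast)
  then show ?case
    unfolding G_def normalized_sum_def centered_def divide_inverse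
    by (intro allI continuous_on_mult_right continuous_on_sum continuous_on_diff mean_continuous)
qed

lemma G_diff: "G n s \<omega> - G n t \<omega> = normalized_sum (\<lambda>x. centered s x - centered t x) n \<omega>"
  unfolding G_def normalized_sum_def by (simp add: sum_subtractf diff_divide_distrib)

text \<open>For positive \<open>n\<close> the expected squared increment is the variance of \<open>h s - h t\<close>, which is at most
  its second moment; for \<open>n = 0\<close> it is zero.\<close>

lemma second_moment_G_increment:
  assumes st: "s \<in> {a..b}" "t \<in> {a..b}"
  shows "integrable M (\<lambda>\<omega>. (G n s \<omega> - G n t \<omega>)\<^sup>2)"
    and "(\<integral>\<omega>. (G n s \<omega> - G n t \<omega>)\<^sup>2 \<partial>M) \<le> (\<integral>x. (K x)\<^sup>2 \<partial>\<mu>) * (s - t)\<^sup>2"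
proof -
  let ?w = "\<lambda>x. centered s x - centered t x" and ?d = "\<lambda>x. h s x - h t x"
  have [measurable]: "?w \<in> borel_measurable borel"
    using centered_measurable st by (intro borel_measurable_diff)
  have prod: "integrable \<mu> (\<lambda>x. centered s x * centered t x)" "integrable \<mu> (\<lambda>x. h s x * h t x)"
    using st centered_measurable h_measurable
    by (auto intro!: integrable_mult_if_square_integrable centered_square h_square)
  have sq: "integrable \<mu> (\<lambda>x. (?w x)\<^sup>2)" "integrable \<mu> (\<lambda>x. (?d x)\<^sup>2)"
    unfolding power2_diff using prod centered_square h_square st by (auto simp: mult.assoc)
  have mean: "(\<integral>x. ?w x \<partial>\<mu>) = 0"
    using centered_mean centered_integrable st by simp
  show "integrable M (\<lambda>\<omega>. (G n s \<omega> - G n t \<omega>)\<^sup>2)"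
    unfolding G_diff by (rule integrable_square_normalized_sum[OF _ sq(1)]) simp
  have "(\<integral>\<omega>. (G n s \<omega> - G n t \<omega>)\<^sup>2 \<partial>M) \<le> (\<integral>x. (?w x)\<^sup>2 \<partial>\<mu>)"
    unfolding G_diff by (rule second_moment_normalized_sum[OF _ sq(1) mean]) simp
  also have "\<dots> = \<mu>.variance ?d"
    using h_integrable st by (simp add: centered_def mean_def algebra_simps)
  also have "\<dots> \<le> (\<integral>x. (?d x)\<^sup>2 \<partial>\<mu>)"
    by (subst \<mu>.variance_eq) (use h_integrable sq(2) st in auto)
  also have "\<dots> \<le> (\<integral>x. (K x)\<^sup>2 * (s - t)\<^sup>2 \<partial>\<mu>)"
  proof (rule integral_mono_AE[OF sq(2)])
    show "AE x in \<mu>. (?d x)\<^sup>2 \<le> (K x)\<^sup>2 * (s - t)\<^sup>2"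
      using h_Lipschitz
    proof eventually_elim
      case (elim x)
      then have "\<bar>?d x\<bar> \<le> \<bar>K x * (s - t)\<bar>"
        using st abs_ge_self[of "K x * \<bar>s - t\<bar>"] by (fastforce simp: abs_mult)
      then show ?case by (simp add: abs_le_square_iff power_mult_distrib)
    qed
  qed (use K_square in simp)
  finally show "(\<integral>\<omega>. (G n s \<omega> - G n t \<omega>)\<^sup>2 \<partial>M) \<le> (\<integral>x. (K x)\<^sup>2 \<partial>\<mu>) * (s - t)\<^sup>2"
    by simp
qed

lemma expectation_grid_energy_G:
  assumes "a < b"
  shows "integrable M (\<lambda>\<omega>. grid_energy a b (\<lambda>t. G n t \<omega>) N)"
    and "(\<integral>\<omega>. grid_energy a b (\<lambda>t. G n t \<omega>) N \<partial>M) \<le> (b - a) * (\<integral>x. (K x)\<^sup>2 \<partial>\<mu>)"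
proof -
  define C where "C = (\<integral>x. (K x)\<^sup>2 \<partial>\<mu>)"
  have "C \<ge> 0" unfolding C_def by simp
  let ?p = "grid_point a b N"
  have p: "?p k \<in> {a..b}" "?p (Suc k) \<in> {a..b}" if "k < N" for k
    using grid_point_in[of a b] ab that by simp_all
  note G2 = second_moment_G_increment[OF p(2) p(1)]
  show "integrable M (\<lambda>\<omega>. grid_energy a b (\<lambda>t. G n t \<omega>) N)"
    unfolding grid_energy_def
    by (intro integrable_mult_right Bochner_Integration.integrable_sum G2) auto
  have "(\<integral>\<omega>. grid_energy a b (\<lambda>t. G n t \<omega>) N \<partial>M)
      = N / (b - a) * (\<Sum>k<N. \<integral>\<omega>. (G n (?p (Suc k)) \<omega> - G n (?p k) \<omega>)\<^sup>2 \<partial>M)"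
    unfolding grid_energy_def using G2(1) by simp
  also have "\<dots> \<le> N / (b - a) * (\<Sum>k<N. C * ((b - a) / N)\<^sup>2)"
  proof (intro mult_left_mono sum_mono)
    fix k assume "k \<in> {..<N}"
    then have k: "k < N" by simp
    have "?p (Suc k) - ?p k = (b - a) / N"
      unfolding grid_point_def by (simp add: add_divide_distrib distrib_right)
    with G2(2)[OF k k, of n] show "(\<integral>\<omega>. (G n (?p (Suc k)) \<omega> - G n (?p k) \<omega>)\<^sup>2 \<partial>M) \<le> C * ((b - a) / N)\<^sup>2"
      by (simp add: C_def)
  qed (use assms in simp)
  also have "\<dots> \<le> (b - a) * C"
    using assms \<open>C \<ge> 0\<close> by (cases "N = 0") (auto simp: power2_eq_square)
  finally show "(\<integral>\<omega>. grid_energy a b (\<lambda>t. G n t \<omega>) N \<partial>M) \<le> (b - a) * (\<integral>x. (K x)\<^sup>2 \<partial>\<mu>)"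
    by (simp add: C_def)
qed

text \<open>The expected grid energy of \<open>G n\<close> is bounded uniformly in the grid. By Fatou's lemma so is the expectation
  of its lower limit, which serves as \<open>W\<close>.\<close>

lemma G_modulus:
  obtains W :: "'a \<Rightarrow> real" where "integrable M W" "\<And>\<omega>. 0 \<le> W \<omega>"
    "(\<integral>\<omega>. W \<omega> \<partial>M) \<le> (b - a) * (\<integral>x. (K x)\<^sup>2 \<partial>\<mu>)"
    "AE \<omega> in M. \<forall>s\<in>{a..b}. \<forall>t\<in>{a..b}. (G n s \<omega> - G n t \<omega>)\<^sup>2 \<le> \<bar>s - t\<bar> * W \<omega>"
proof (cases "a < b")
  case False
  have "(G n s \<omega> - G n t \<omega>)\<^sup>2 \<le> \<bar>s - t\<bar> * 0" if "s \<in> {a..b}" "t \<in> {a..b}" for s t \<omega>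
  proof -
    have "s = t" using that False by auto
    then show ?thesis by simp
  qed
  then have "AE \<omega> in M. \<forall>s\<in>{a..b}. \<forall>t\<in>{a..b}. (G n s \<omega> - G n t \<omega>)\<^sup>2 \<le> \<bar>s - t\<bar> * 0"
    by (intro always_eventually allI ballI)
  moreover have "0 \<le> (b - a) * (\<integral>x. (K x)\<^sup>2 \<partial>\<mu>)" using ab by simp
  ultimately show ?thesis by (intro that[of "\<lambda>_. 0"]) simp_all
next
  case True
  define C where "C = (b - a) * (\<integral>x. (K x)\<^sup>2 \<partial>\<mu>)"
  have "C \<ge> 0" unfolding C_def using ab by simp
  define Q where "Q N \<omega> = ennreal (grid_energy a b (\<lambda>t. G n t \<omega>) N)" for N \<omega>
  define W' where "W' \<omega> = liminf (\<lambda>N. Q N \<omega>)" for \<omega>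
  have Qm [measurable]: "Q N \<in> borel_measurable M" for N
    unfolding Q_def using borel_measurable_integrable[OF expectation_grid_energy_G(1)[OF True]] by simp
  have [measurable]: "W' \<in> borel_measurable M" unfolding W'_def by measurable
  have "(\<integral>\<^sup>+\<omega>. Q N \<omega> \<partial>M) \<le> ennreal C" for N
    unfolding Q_def C_def
    by (subst nn_integral_eq_integral)
       (auto intro: expectation_grid_energy_G[OF True] grid_energy_nonneg[OF True] ennreal_leI)
  then have "liminf (\<lambda>N. \<integral>\<^sup>+\<omega>. Q N \<omega> \<partial>M) \<le> liminf (\<lambda>N. ennreal C)"
    by (intro Liminf_mono always_eventually) auto
  moreover have "(\<integral>\<^sup>+\<omega>. W' \<omega> \<partial>M) \<le> liminf (\<lambda>N. \<integral>\<^sup>+\<omega>. Q N \<omega> \<partial>M)"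
    unfolding W'_def by (rule nn_integral_liminf) simp
  ultimately have W'le: "(\<integral>\<^sup>+\<omega>. W' \<omega> \<partial>M) \<le> ennreal C"
    by (simp add: Liminf_const)
  then have fin: "AE \<omega> in M. W' \<omega> \<noteq> \<infinity>"
    by (intro nn_integral_PInf_AE) (auto simp: top_unique)
  have eq: "(\<integral>\<^sup>+\<omega>. ennreal (enn2real (W' \<omega>)) \<partial>M) = (\<integral>\<^sup>+\<omega>. W' \<omega> \<partial>M)"
    using fin by (intro nn_integral_cong_AE) (auto simp: less_top)
  have int: "integrable M (\<lambda>\<omega>. enn2real (W' \<omega>))"
    using W'le by (intro integrableI_nonneg) (auto simp: eq less_top[symmetric] top_unique)
  have "(\<integral>\<omega>. enn2real (W' \<omega>) \<partial>M) \<le> C"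
    using W'le nn_integral_eq_integral[OF int] \<open>C \<ge> 0\<close> by (simp add: eq)
  moreover have "AE \<omega> in M. \<forall>s\<in>{a..b}. \<forall>t\<in>{a..b}. (G n s \<omega> - G n t \<omega>)\<^sup>2 \<le> \<bar>s - t\<bar> * enn2real (W' \<omega>)"
    using fin G_continuous
  proof eventually_elim
    case (elim \<omega>)
    then have "liminf (\<lambda>N. ennreal (grid_energy a b (\<lambda>t. G n t \<omega>) N)) = ennreal (enn2real (W' \<omega>))"
      by (simp add: W'_def Q_def less_top)
    then show ?case
      using square_increment_le_liminf_grid_energy[OF True, of "\<lambda>t. G n t \<omega>"] elim(2) by simp
  qed
  ultimately show ?thesis using that[of "\<lambda>\<omega>. enn2real (W' \<omega>)"] int unfolding C_def by simp
qed

end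

section \<open>Finite nets, minima and test functions\<close>

lemma Min_image_attained:
  fixes y :: "'i \<Rightarrow> real"
  assumes "finite F" "F \<noteq> {}"
  obtains s where "s \<in> F" "(MIN t\<in>F. y t) = y s"
proof -
  have "(MIN t\<in>F. y t) \<in> y ` F" by (rule Min_in) (use assms in auto)
  then show ?thesis by (elim imageE) (rule that)
qed

lemma Min_image_diff_le_sum:
  fixes x y :: "'i \<Rightarrow> real"
  assumes "finite F" "F \<noteq> {}"
  shows "\<bar>(MIN t\<in>F. x t) - (MIN t\<in>F. y t)\<bar> \<le> (\<Sum>t\<in>F. \<bar>x t - y t\<bar>)"
proof -
  have *: "(MIN t\<in>F. x t) \<le> (MIN t\<in>F. y t) + (\<Sum>t\<in>F. \<bar>x t - y t\<bar>)" for x y :: "'i \<Rightarrow> real"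
  proof -
    obtain s where s: "s \<in> F" "(MIN t\<in>F. y t) = y s"
      using Min_image_attained[OF assms] by blast
    have "(MIN t\<in>F. x t) \<le> x s" using s(1) assms by simp
    moreover have "\<bar>x s - y s\<bar> \<le> (\<Sum>t\<in>F. \<bar>x t - y t\<bar>)"
      using member_le_sum[of s F "\<lambda>t. \<bar>x t - y t\<bar>"] s(1) assms by simp
    ultimately show ?thesis using s(2) by linarith
  qed
  show ?thesis using *[of x y] *[of y x] by (simp add: abs_le_iff abs_minus_commute)
qed

lemma compact_finite_nets:
  fixes S :: "real set"
  assumes "compact S" "S \<noteq> {}"
  shows "\<exists>F :: nat \<Rightarrow> real set. \<forall>k. finite (F k) \<and> F k \<noteq> {} \<and> F k \<subseteq> S \<and>
    (\<forall>s\<in>S. \<exists>t\<in>F k. \<bar>s - t\<bar> < 1 / real (Suc k))"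
proof -
  have "\<exists>F. finite F \<and> F \<noteq> {} \<and> F \<subseteq> S \<and> (\<forall>s\<in>S. \<exists>t\<in>F. \<bar>s - t\<bar> < 1 / real (Suc k))" for k
  proof -
    have "\<And>T. T \<in> S \<Longrightarrow> open (ball T (1 / real (Suc k)))" by simp
    moreover have "S \<subseteq> (\<Union>t\<in>S. ball t (1 / real (Suc k)))" by force
    ultimately obtain F where F: "F \<subseteq> S" "finite F" "S \<subseteq> (\<Union>t\<in>F. ball t (1 / real (Suc k)))"
      by (rule compactE_image[OF assms(1)])
    moreover have "F \<noteq> {}" using F(3) assms(2) by auto
    moreover have "\<exists>t\<in>F. \<bar>s - t\<bar> < 1 / real (Suc k)" if "s \<in> S" for s
      using F(3) that by (force simp: dist_real_def abs_minus_commute)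
    ultimately show ?thesis by blast
  qed
  then show ?thesis by (intro choice allI)
qed

lemma Min_nets_tendsto_INF:
  fixes y :: "real \<Rightarrow> real"
  assumes S: "compact S" "S \<noteq> {}" and y: "continuous_on S y"
    and F: "\<And>k. finite (F k)" "\<And>k. F k \<noteq> {}" "\<And>k. F k \<subseteq> S"
      "\<And>k s. s \<in> S \<Longrightarrow> \<exists>t\<in>F k. \<bar>s - t\<bar> < 1 / real (Suc k)"
  shows "(\<lambda>k. MIN t\<in>F k. y t) \<longlonglongrightarrow> (INF t\<in>S. y t)"
proof -
  obtain s0 where s0: "s0 \<in> S" "\<And>s. s \<in> S \<Longrightarrow> y s0 \<le> y s"
    using continuous_attains_inf[OF S y] by blast
  then have inf: "(INF t\<in>S. y t) = y s0" by (intro cInf_eq_minimum) auto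
  \<comment> \<open>The net points \<open>p k\<close> approach the minimizer \<open>s0\<close> and squeeze the minima over the nets.\<close>
  define p where "p k = (SOME t. t \<in> F k \<and> \<bar>s0 - t\<bar> < 1 / real (Suc k))" for k
  have "p k \<in> F k \<and> \<bar>s0 - p k\<bar> < 1 / real (Suc k)" for k
    unfolding p_def by (rule someI_ex) (use F(4)[OF s0(1)] in blast)
  then have p: "p k \<in> F k" "\<bar>s0 - p k\<bar> < 1 / real (Suc k)" for k by auto
  have "(\<lambda>k. \<bar>p k - s0\<bar>) \<longlonglongrightarrow> 0"
  proof (rule tendsto_sandwich[OF _ _ tendsto_const])
    show "(\<lambda>k. 1 / real (Suc k)) \<longlonglongrightarrow> 0" using LIMSEQ_inverse_real_of_nat by (simp add: inverse_eq_divide)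
    show "\<forall>\<^sub>F k in sequentially. \<bar>p k - s0\<bar> \<le> 1 / real (Suc k)"
      using p(2) by (intro always_eventually allI) (simp add: abs_minus_commute less_imp_le)
  qed simp
  then have "(\<lambda>k. p k - s0) \<longlonglongrightarrow> 0" by (rule tendsto_rabs_zero_cancel)
  then have "p \<longlonglongrightarrow> s0" by (rule LIM_zero_cancel)
  moreover have pS: "p k \<in> S" for k using p(1) F(3)[of k] by blast
  ultimately have "(\<lambda>k. y (p k)) \<longlonglongrightarrow> y s0"
    by (intro continuous_on_tendsto_compose[OF y _ s0(1)] always_eventually allI)
  moreover have "(MIN t\<in>F k. y t) \<le> y (p k)" for k using F(1) p(1) by simp
  moreover have "y s0 \<le> (MIN t\<in>F k. y t)" for k
  proof -
    obtain s where s: "s \<in> F k" "(MIN t\<in>F k. y t) = y s"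
      using Min_image_attained[of "F k" y] F(1)[of k] F(2)[of k] by blast
    then have "s \<in> S" using F(3)[of k] by blast
    then show ?thesis using s0(2)[of s] s(2) by simp
  qed
  ultimately show ?thesis unfolding inf
    by (intro tendsto_sandwich[of "\<lambda>_. y s0" "\<lambda>k. MIN t\<in>F k. y t" sequentially "\<lambda>k. y (p k)"]
        always_eventually allI tendsto_const)
qed

lemma cts_step_eq_clamp:
  assumes "x < y" shows "cts_step x y u = max 0 (min 1 ((y - u) / (y - x)))"
  using assms unfolding cts_step_def by (auto simp: max_def min_def field_simps)

lemma cts_step_Lipschitz:
  assumes "x < y" shows "\<bar>cts_step x y u - cts_step x y v\<bar> \<le> 1 / (y - x) * \<bar>u - v\<bar>"
proof -
  have "\<bar>cts_step x y u - cts_step x y v\<bar> \<le> \<bar>(y - u) / (y - x) - (y - v) / (y - x)\<bar>"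
  proof -
    have "\<bar>max 0 (min 1 p) - max 0 (min 1 q)\<bar> \<le> \<bar>p - q\<bar>" for p q :: real
      by (auto simp: max_def min_def)
    then show ?thesis unfolding cts_step_eq_clamp[OF assms] .
  qed
  also have "\<dots> = \<bar>(v - u) / (y - x)\<bar>" by (simp add: diff_divide_distrib)
  also have "\<dots> = 1 / (y - x) * \<bar>u - v\<bar>" using assms by (simp add: abs_minus_commute)
  finally show ?thesis .
qed

lemma abs_cts_step_le_one: "x < y \<Longrightarrow> \<bar>cts_step x y u\<bar> \<le> 1"
  by (simp add: cts_step_eq_clamp)

section \<open>Comparing the scaled optimality gap with a finite minimum\<close>

text \<open>The points of \<open>[a, b]\<close> at distance at least \<open>\<delta>\<close> from \<open>F\<close> form a compact set that contains no
  minimizer, so that the minimum of \<open>f\<close> over it exceeds \<open>v\<close>.\<close>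

lemma continuous_separated_from_argmin:
  fixes f :: "real \<Rightarrow> real"
  assumes f: "continuous_on {a..b} f" and d: "0 < \<delta>"
    and min: "\<And>t. t \<in> {a..b} \<Longrightarrow> v \<le> f t"
    and net: "\<And>s. s \<in> {a..b} \<Longrightarrow> f s = v \<Longrightarrow> \<exists>t\<in>F. \<bar>s - t\<bar> < \<delta>"
  obtains \<eta> where "0 < \<eta>" "\<And>t. t \<in> {a..b} \<Longrightarrow> (\<And>s. s \<in> F \<Longrightarrow> \<delta> \<le> \<bar>t - s\<bar>) \<Longrightarrow> v + \<eta> \<le> f t"
proof -
  define D where "D = {a..b} - (\<Union>s\<in>F. ball s \<delta>)"
  have D: "t \<in> D" if "t \<in> {a..b}" "\<And>s. s \<in> F \<Longrightarrow> \<delta> \<le> \<bar>t - s\<bar>" for t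
    using that by (force simp: D_def dist_real_def abs_minus_commute)
  show ?thesis
  proof (cases "D = {}")
    case True
    then show ?thesis using D by (intro that[of 1]) auto
  next
    case False
    have "compact D" unfolding D_def by (intro compact_diff open_UN) auto
    moreover have "continuous_on D f" using f by (rule continuous_on_subset) (auto simp: D_def)
    ultimately obtain t0 where t0: "t0 \<in> D" "\<And>t. t \<in> D \<Longrightarrow> f t0 \<le> f t"
      using continuous_attains_inf[OF _ False] by blast
    have t0ab: "t0 \<in> {a..b}" using t0(1) unfolding D_def by blast
    have "f t0 \<noteq> v"
    proof
      assume "f t0 = v"
      then obtain t where "t \<in> F" "\<bar>t0 - t\<bar> < \<delta>" using net[OF t0ab] by blast
      then have "t0 \<in> (\<Union>s\<in>F. ball s \<delta>)" by (force simp: dist_real_def abs_minus_commute)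
      then show False using t0(1) unfolding D_def by blast
    qed
    with min[OF t0ab] have "0 < f t0 - v" by simp
    then show ?thesis using D t0(2) by (intro that[of "f t0 - v"]) auto
  qed
qed

text \<open>The gap is at most the value of \<open>g\<close> at any point of \<open>F\<close>. Conversely, within distance \<open>\<delta>\<close> of some \<open>s\<close>
  in \<open>F\<close> the function \<open>g\<close> falls below \<open>g s\<close> by at most \<open>sqrt (\<delta> W)\<close>, and elsewhere
  the drift \<open>r * \<eta>\<close> outweighs any drop of \<open>g\<close> by \<open>x\<close>, up to an excess of at most \<open>x\<^sup>2 / (4 r \<eta>)\<close>. Both
  errors are bounded by expressions affine in \<open>W\<close>, since only the expectation of \<open>W\<close> is controlled.\<close>

lemma scaled_gap_near_finite_minimum:
  fixes f g :: "real \<Rightarrow> real"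
  assumes ab: "a \<le> b" and F: "finite F" "F \<noteq> {}" "F \<subseteq> {a..b}" "\<And>s. s \<in> F \<Longrightarrow> f s = v"
    and pos: "0 < r" "0 < \<delta>" "0 < \<eta>" "0 \<le> W"
    and min: "\<And>t. t \<in> {a..b} \<Longrightarrow> v \<le> f t"
    and sep: "\<And>t. t \<in> {a..b} \<Longrightarrow> (\<And>s. s \<in> F \<Longrightarrow> \<delta> \<le> \<bar>t - s\<bar>) \<Longrightarrow> v + \<eta> \<le> f t"
    and modulus: "\<And>s t. s \<in> {a..b} \<Longrightarrow> t \<in> {a..b} \<Longrightarrow> (g s - g t)\<^sup>2 \<le> \<bar>s - t\<bar> * W"
  shows "\<bar>r * ((INF t\<in>{a..b}. f t + g t / r) - v) - (MIN s\<in>F. g s)\<bar>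
    \<le> sqrt \<delta> * (1 + W) / 2 + (b - a) * W / (4 * r * \<eta>)"
proof -
  define R where "R = sqrt \<delta> * (1 + W) / 2 + (b - a) * W / (4 * r * \<eta>)"
  define m where "m = (MIN s\<in>F. g s)"
  obtain s0 where s0: "s0 \<in> F" "m = g s0"
    using Min_image_attained[OF F(1,2), of g] unfolding m_def by blast
  have R: "sqrt \<delta> * (1 + W) / 2 \<le> R" "(b - a) * W / (4 * r * \<eta>) \<le> R"
    unfolding R_def using ab pos by simp_all
  have lower: "v + (m - R) / r \<le> f t + g t / r" if t: "t \<in> {a..b}" for t
  proof (cases "\<exists>s\<in>F. \<bar>t - s\<bar> < \<delta>")
    case True
    then obtain s where s: "s \<in> F" "\<bar>t - s\<bar> < \<delta>" by blast
    have "(g s - g t)\<^sup>2 \<le> \<bar>s - t\<bar> * W" using modulus s(1) F(3) t by blast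
    also have "\<dots> \<le> \<delta> * W" using s(2) pos by (intro mult_right_mono) auto
    finally have "\<bar>g s - g t\<bar> \<le> sqrt (\<delta> * W)" by (rule real_le_rsqrt[of "\<bar>g s - g t\<bar>", simplified])
    also have "\<dots> \<le> sqrt \<delta> * ((1 + W) / 2)"
      using arith_geo_mean_sqrt[of 1 W] pos by (simp add: real_sqrt_mult mult_left_mono)
    also have "\<dots> \<le> R" using R(1) by simp
    finally have "g s - R \<le> g t" by linarith
    moreover have "m \<le> g s" unfolding m_def using s(1) F(1) by simp
    ultimately have "(m - R) / r \<le> g t / r" using pos by (intro divide_right_mono) auto
    then show ?thesis using min[OF t] by linarith
  next
    case False
    then have far: "v + \<eta> \<le> f t" using sep[OF t] by (meson not_le)
    define x where "x = g s0 - g t"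
    have "s0 \<in> {a..b}" using s0(1) F(3) by blast
    then have "x\<^sup>2 \<le> \<bar>s0 - t\<bar> * W" unfolding x_def using modulus t by blast
    also have "\<dots> \<le> (b - a) * W" using \<open>s0 \<in> {a..b}\<close> t pos by (intro mult_right_mono) auto
    finally have x2: "x\<^sup>2 \<le> (b - a) * W" .
    \<comment> \<open>This yields \<open>x - r \<eta> \<le> x\<^sup>2 / (4 r \<eta>)\<close>.\<close>
    have "0 \<le> (x - 2 * r * \<eta>)\<^sup>2" by simp
    then have "4 * r * \<eta> * x \<le> x\<^sup>2 + 4 * r * \<eta> * (r * \<eta>)"
      by (simp add: power2_eq_square algebra_simps)
    then have "4 * r * \<eta> * (x - r * \<eta>) \<le> (b - a) * W" using x2 by (simp add: right_diff_distrib)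
    then have "x - r * \<eta> \<le> (b - a) * W / (4 * r * \<eta>)"
      using pos by (simp add: pos_le_divide_eq mult.commute)
    then have "m - R \<le> r * \<eta> + g t" using R(2) s0(2) unfolding x_def by linarith
    then have "(m - R) / r \<le> (r * \<eta> + g t) / r" using pos by (intro divide_right_mono) auto
    also have "\<dots> = \<eta> + g t / r" using pos by (simp add: add_divide_distrib)
    finally show ?thesis using far by linarith
  qed
  have "(INF t\<in>{a..b}. f t + g t / r) \<le> f s0 + g s0 / r"
    using s0(1) F(3) by (intro cINF_lower bdd_belowI2[of _ "v + (m - R) / r"] lower) auto
  then have "(INF t\<in>{a..b}. f t + g t / r) - v \<le> m / r" using F(4)[OF s0(1)] s0(2) by simp
  then have "r * ((INF t\<in>{a..b}. f t + g t / r) - v) \<le> m"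
    using pos by (simp add: pos_le_divide_eq mult.commute)
  moreover have "v + (m - R) / r \<le> (INF t\<in>{a..b}. f t + g t / r)"
    using ab by (intro cINF_greatest lower) auto
  then have "(m - R) / r \<le> (INF t\<in>{a..b}. f t + g t / r) - v" by simp
  then have "m - R \<le> r * ((INF t\<in>{a..b}. f t + g t / r) - v)"
    using pos by (simp add: pos_divide_le_eq mult.commute)
  moreover have "0 \<le> R" unfolding R_def using ab pos by simp
  ultimately show ?thesis unfolding m_def[symmetric] R_def[symmetric] by linarith
qed

section \<open>The limit law of the scaled optimality gap\<close>

context lipschitz_sample
begin

lemma expectation_gap_minus_finite_minimum:
  fixes \<psi> :: "real \<Rightarrow> real"
  assumes F: "finite F" "F \<noteq> {}" "F \<subseteq> {a..b}" "\<And>s. s \<in> F \<Longrightarrow> f s = v"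
    and pos: "0 < n" "0 < \<delta>" "0 < \<eta>"
    and min: "\<And>t. t \<in> {a..b} \<Longrightarrow> v \<le> f t"
    and sep: "\<And>t. t \<in> {a..b} \<Longrightarrow> (\<And>s. s \<in> F \<Longrightarrow> \<delta> \<le> \<bar>t - s\<bar>) \<Longrightarrow> v + \<eta> \<le> f t"
    and Z [measurable]: "Z \<in> borel_measurable M"
    and Z_eq: "AE \<omega> in M. Z \<omega> = sqrt n * ((INF t\<in>{a..b}. f t + G n t \<omega> / sqrt n) - v)"
    and lip: "\<And>x y. \<bar>\<psi> x - \<psi> y\<bar> \<le> L * \<bar>x - y\<bar>" and bdd: "\<And>x. \<bar>\<psi> x\<bar> \<le> B"
  defines "C \<equiv> (b - a) * (\<integral>x. (K x)\<^sup>2 \<partial>\<mu>)"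
  shows "\<bar>(\<integral>\<omega>. \<psi> (Z \<omega>) \<partial>M) - (\<integral>\<omega>. \<psi> (MIN s\<in>F. G n s \<omega>) \<partial>M)\<bar>
    \<le> L * (sqrt \<delta> * (1 + C) / 2 + (b - a) * C / (4 * sqrt n * \<eta>))"
proof -
  have L: "0 \<le> L" using order_trans[OF abs_ge_zero lip[of 0 1]] by simp
  have [measurable]: "\<psi> \<in> borel_measurable borel"
    using lip by (rule borel_measurable_if_Lipschitz)
  have Gm: "G n s \<in> borel_measurable M" if "s \<in> F" for s using that F(3) by (intro G_measurable) auto
  have [measurable]: "(\<lambda>\<omega>. MIN s\<in>F. G n s \<omega>) \<in> borel_measurable M"
    by (rule borel_measurable_Min[OF F(1) Gm])
  obtain W where W: "integrable M W" "\<And>\<omega>. 0 \<le> W \<omega>" "(\<integral>\<omega>. W \<omega> \<partial>M) \<le> C"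
    "AE \<omega> in M. \<forall>s\<in>{a..b}. \<forall>t\<in>{a..b}. (G n s \<omega> - G n t \<omega>)\<^sup>2 \<le> \<bar>s - t\<bar> * W \<omega>"
    using G_modulus[of n] unfolding C_def by blast
  define R where "R w = L * (sqrt \<delta> * (1 + w) / 2 + (b - a) * w / (4 * sqrt n * \<eta>))" for w
  have R_affine: "R w = L * sqrt \<delta> / 2 + (L * sqrt \<delta> / 2 + L * (b - a) / (4 * sqrt n * \<eta>)) * w" for w
    unfolding R_def by (simp add: algebra_simps add_divide_distrib)
  have close: "AE \<omega> in M. \<bar>\<psi> (Z \<omega>) - \<psi> (MIN s\<in>F. G n s \<omega>)\<bar> \<le> R (W \<omega>)"
    using W(4) Z_eq
  proof eventually_elim
    case (elim \<omega>)
    have "\<bar>Z \<omega> - (MIN s\<in>F. G n s \<omega>)\<bar>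
        \<le> sqrt \<delta> * (1 + W \<omega>) / 2 + (b - a) * W \<omega> / (4 * sqrt n * \<eta>)"
      unfolding elim(2)
      by (rule scaled_gap_near_finite_minimum[OF ab F]) (use pos W(2) min sep elim(1) in auto)
    then show ?case unfolding R_def
      using lip[of "Z \<omega>" "MIN s\<in>F. G n s \<omega>"] L by (meson mult_left_mono order_trans)
  qed
  have i1: "integrable M (\<lambda>\<omega>. \<psi> (Z \<omega>))" "integrable M (\<lambda>\<omega>. \<psi> (MIN s\<in>F. G n s \<omega>))"
    by (rule integrable_const_bound[of _ B]; use bdd in simp)+
  have iR: "integrable M (\<lambda>\<omega>. R (W \<omega>))" unfolding R_affine using W(1) by simp
  have "\<bar>(\<integral>\<omega>. \<psi> (Z \<omega>) \<partial>M) - (\<integral>\<omega>. \<psi> (MIN s\<in>F. G n s \<omega>) \<partial>M)\<bar>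
      = \<bar>\<integral>\<omega>. \<psi> (Z \<omega>) - \<psi> (MIN s\<in>F. G n s \<omega>) \<partial>M\<bar>"
    using i1 by simp
  also have "\<dots> \<le> (\<integral>\<omega>. \<bar>\<psi> (Z \<omega>) - \<psi> (MIN s\<in>F. G n s \<omega>)\<bar> \<partial>M)"
    by (rule integral_abs_bound)
  also have "\<dots> \<le> (\<integral>\<omega>. R (W \<omega>) \<partial>M)"
    by (rule integral_mono_AE[OF _ iR close]) (use i1 in simp)
  also have "\<dots> = R (\<integral>\<omega>. W \<omega> \<partial>M)" unfolding R_affine using W(1) by (simp add: prob_space)
  also have "\<dots> \<le> R C"
    unfolding R_affine using W(3) L ab pos by (intro add_left_mono mult_left_mono) auto
  finally show ?thesis unfolding R_def .
qed

text \<open>The net is fixed first, fine enough for the \<open>\<delta>\<close> part of the error and for \<open>I k\<close> to be near \<open>J\<close>; the part with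
  \<open>sqrt n\<close> in the denominator then vanishes as \<open>n\<close> grows.\<close>

lemma scaled_gap_test_function_limit:
  fixes \<psi> :: "real \<Rightarrow> real"
  assumes f: "continuous_on {a..b} f" and min: "\<And>t. t \<in> {a..b} \<Longrightarrow> v \<le> f t"
    and Z: "\<And>n. Z n \<in> borel_measurable M"
    and Z_eq: "\<And>n. 0 < n \<Longrightarrow>
      AE \<omega> in M. Z n \<omega> = sqrt n * ((INF t\<in>{a..b}. f t + G n t \<omega> / sqrt n) - v)"
    and F: "\<And>k. finite (F k)" "\<And>k. F k \<noteq> {}" "\<And>k. F k \<subseteq> {t\<in>{a..b}. f t = v}"
      "\<And>k s. s \<in> {t\<in>{a..b}. f t = v} \<Longrightarrow> \<exists>t\<in>F k. \<bar>s - t\<bar> < 1 / real (Suc k)"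
    and lip: "\<And>x y. \<bar>\<psi> x - \<psi> y\<bar> \<le> L * \<bar>x - y\<bar>" and bdd: "\<And>x. \<bar>\<psi> x\<bar> \<le> B"
    and I: "\<And>k. (\<lambda>n. \<integral>\<omega>. \<psi> (MIN s\<in>F k. G n s \<omega>) \<partial>M) \<longlonglongrightarrow> I k" and J: "I \<longlonglongrightarrow> J"
  shows "(\<lambda>n. \<integral>\<omega>. \<psi> (Z n \<omega>) \<partial>M) \<longlonglongrightarrow> J"
proof (rule LIMSEQ_I)
  fix e :: real assume e: "0 < e"
  define C where "C = (b - a) * (\<integral>x. (K x)\<^sup>2 \<partial>\<mu>)"
  have inv: "(\<lambda>k. 1 / real (Suc k)) \<longlonglongrightarrow> 0"
    using LIMSEQ_inverse_real_of_nat by (simp only: inverse_eq_divide)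
  have "(\<lambda>k. L * (sqrt (1 / real (Suc k)) * (1 + C) / 2)) \<longlonglongrightarrow> L * (sqrt 0 * (1 + C) / 2)"
    by (intro tendsto_intros inv) simp
  then have "(\<lambda>k. L * (sqrt (1 / real (Suc k)) * (1 + C) / 2)) \<longlonglongrightarrow> 0"
    by (simp only: real_sqrt_zero mult_zero_left mult_zero_right div_0)
  then have "\<forall>\<^sub>F k in sequentially. L * (sqrt (1 / real (Suc k)) * (1 + C) / 2) < e / 4"
    by (rule order_tendstoD(2)) (use e in simp)
  moreover have "\<forall>\<^sub>F k in sequentially. \<bar>I k - J\<bar> < e / 4"
    using tendstoD[OF J, of "e / 4"] e by (simp add: dist_real_def)
  ultimately have "\<forall>\<^sub>F k in sequentially. L * (sqrt (1 / real (Suc k)) * (1 + C) / 2) < e / 4 \<and> \<bar>I k - J\<bar> < e / 4"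
    by (rule eventually_conj)
  then obtain k where k: "L * (sqrt (1 / real (Suc k)) * (1 + C) / 2) < e / 4" "\<bar>I k - J\<bar> < e / 4"
    using eventually_happens'[OF sequentially_bot] by blast
  define \<delta> where "\<delta> = 1 / real (Suc k)"
  have "0 < \<delta>" by (simp add: \<delta>_def)
  have "\<exists>t\<in>F k. \<bar>s - t\<bar> < \<delta>" if "s \<in> {a..b}" "f s = v" for s
    using F(4)[of s k] that unfolding \<delta>_def by simp
  then obtain \<eta> where \<eta>: "0 < \<eta>"
    "\<And>t. t \<in> {a..b} \<Longrightarrow> (\<And>s. s \<in> F k \<Longrightarrow> \<delta> \<le> \<bar>t - s\<bar>) \<Longrightarrow> v + \<eta> \<le> f t"
    using continuous_separated_from_argmin[OF f \<open>0 < \<delta>\<close> min] by metis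
  have "(\<lambda>n. L * ((b - a) * C / (4 * \<eta>)) * (1 / sqrt (real n))) \<longlonglongrightarrow> L * ((b - a) * C / (4 * \<eta>)) * 0"
    by (intro tendsto_mult tendsto_const) real_asymp
  then have "\<forall>\<^sub>F n in sequentially. L * ((b - a) * C / (4 * \<eta>)) * (1 / sqrt (real n)) < e / 4"
    by (rule order_tendstoD(2)) (use e in simp)
  moreover have "\<forall>\<^sub>F n in sequentially. \<bar>(\<integral>\<omega>. \<psi> (MIN s\<in>F k. G n s \<omega>) \<partial>M) - I k\<bar> < e / 4"
    using tendstoD[OF I, of "e / 4"] e by (simp add: dist_real_def)
  ultimately have "\<forall>\<^sub>F n in sequentially. \<bar>(\<integral>\<omega>. \<psi> (Z n \<omega>) \<partial>M) - J\<bar> < e"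
    using eventually_gt_at_top[of 0]
  proof eventually_elim
    case (elim n)
    have "\<bar>(\<integral>\<omega>. \<psi> (Z n \<omega>) \<partial>M) - (\<integral>\<omega>. \<psi> (MIN s\<in>F k. G n s \<omega>) \<partial>M)\<bar>
        \<le> L * (sqrt \<delta> * (1 + C) / 2 + (b - a) * C / (4 * sqrt n * \<eta>))"
      unfolding C_def
      by (rule expectation_gap_minus_finite_minimum[where f = f and v = v])
         (use F(1,2) F(3)[of k] elim(3) \<open>0 < \<delta>\<close> \<eta> min Z Z_eq lip bdd in auto)
    also have "\<dots> = L * (sqrt \<delta> * (1 + C) / 2) + L * ((b - a) * C / (4 * \<eta>)) * (1 / sqrt (real n))"
      by (simp add: distrib_left)
    finally show ?case using elim(1,2) k unfolding \<delta>_def by linarith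
  qed
  then show "\<exists>n0. \<forall>n\<ge>n0. norm ((\<integral>\<omega>. \<psi> (Z n \<omega>) \<partial>M) - J) < e"
    by (simp add: eventually_sequentially)
qed

lemma linear_combination_G:
  "(\<Sum>t\<in>F. c t * G n t \<omega>) = normalized_sum (\<lambda>x. \<Sum>t\<in>F. c t * centered t x) n \<omega>"
proof -
  have "(\<Sum>t\<in>F. c t * G n t \<omega>) = (\<Sum>t\<in>F. \<Sum>i<n. c t * centered t (X i \<omega>)) / sqrt n"
    unfolding G_def normalized_sum_def by (simp add: sum_divide_distrib sum_distrib_left)
  also have "\<dots> = (\<Sum>i<n. \<Sum>t\<in>F. c t * centered t (X i \<omega>)) / sqrt n"
    by (subst sum.swap) simp
  finally show ?thesis unfolding normalized_sum_def .
qed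

lemma linear_combination_centered:
  assumes F: "finite F" "F \<subseteq> {a..b}"
  shows "(\<lambda>x. \<Sum>t\<in>F. c t * centered t x) \<in> borel_measurable borel"
    and "integrable \<mu> (\<lambda>x. (\<Sum>t\<in>F. c t * centered t x)\<^sup>2)"
    and "(\<integral>x. (\<Sum>t\<in>F. c t * centered t x) \<partial>\<mu>) = 0"
    and "(\<integral>x. (\<Sum>t\<in>F. c t * centered t x)\<^sup>2 \<partial>\<mu>)
      = (\<Sum>s\<in>F. \<Sum>t\<in>F. c s * c t * (\<integral>x. centered s x * centered t x \<partial>\<mu>))"
proof -
  have T: "t \<in> {a..b}" if "t \<in> F" for t using that F(2) by blast
  have m: "centered t \<in> borel_measurable borel" if "t \<in> F" for t
    using centered_measurable[OF T[OF that]] .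
  then show "(\<lambda>x. \<Sum>t\<in>F. c t * centered t x) \<in> borel_measurable borel"
    by (intro borel_measurable_sum borel_measurable_times borel_measurable_const)
  show "integrable \<mu> (\<lambda>x. (\<Sum>t\<in>F. c t * centered t x)\<^sup>2)"
    by (rule integrable_square_sum[OF F(1)])
       (use m centered_square[OF T] in \<open>auto simp: power_mult_distrib\<close>)
  show "(\<integral>x. (\<Sum>t\<in>F. c t * centered t x) \<partial>\<mu>) = 0"
    using centered_integrable[OF T] centered_mean[OF T] by simp
  show "(\<integral>x. (\<Sum>t\<in>F. c t * centered t x)\<^sup>2 \<partial>\<mu>)
      = (\<Sum>s\<in>F. \<Sum>t\<in>F. c s * c t * (\<integral>x. centered s x * centered t x \<partial>\<mu>))"
    by (rule integral_square_linear_combination) (use m centered_square[OF T] in auto)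
qed

text \<open>A normal law is determined by its mean and variance, and these are prescribed by the definition of the process.\<close>

lemma gaussian_linear_combination_law:
  assumes Y: "centered_gaussian_process N {a..b} (\<lambda>s t. \<integral>x. centered s x * centered t x \<partial>\<mu>) Y"
    and F: "finite F" "F \<subseteq> {a..b}"
  shows "distr N borel (\<lambda>\<omega>. \<Sum>t\<in>F. c t * Y t \<omega>)
    = normal_law 0 (\<integral>x. (\<Sum>t\<in>F. c t * centered t x)\<^sup>2 \<partial>\<mu>)"
    and "t \<in> {a..b} \<Longrightarrow> integrable N (\<lambda>\<omega>. (Y t \<omega>)\<^sup>2)"
proof -
  interpret N: prob_space N using Y by (simp add: centered_gaussian_process_def)
  have Ym: "Y t \<in> borel_measurable N" if "t \<in> {a..b}" for t
    using Y that by (simp add: centered_gaussian_process_def)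
  have Yn: "\<exists>m v. 0 \<le> v \<and> distr N borel (\<lambda>\<omega>. \<Sum>t\<in>F. c t * Y t \<omega>) = normal_law m v"
    if "finite F" "F \<subseteq> {a..b}" for F c
    using Y that unfolding centered_gaussian_process_def by blast
  have Y0: "(\<integral>\<omega>. Y t \<omega> \<partial>N) = 0" if "t \<in> {a..b}" for t
    using Y that unfolding centered_gaussian_process_def by blast
  have sq: "integrable N (\<lambda>\<omega>. (Y t \<omega>)\<^sup>2)" if t: "t \<in> {a..b}" for t
  proof -
    obtain m v where "distr N borel (\<lambda>\<omega>. \<Sum>t\<in>{t}. 1 * Y t \<omega>) = normal_law m v"
      using Yn[of "{t}" "\<lambda>_. 1"] t by blast
    then have "distr N borel (Y t) = normal_law m v" by simp
    with integrable_normal_law_square[of m v] have "integrable (distr N borel (Y t)) (\<lambda>x. x\<^sup>2)" by simp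
    then show ?thesis by (subst (asm) integrable_distr_eq[OF Ym[OF t]]) auto
  qed
  then show "t \<in> {a..b} \<Longrightarrow> integrable N (\<lambda>\<omega>. (Y t \<omega>)\<^sup>2)" .
  have T: "t \<in> {a..b}" if "t \<in> F" for t using that F(2) by blast
  have Yi: "integrable N (Y t)" if "t \<in> {a..b}" for t
    by (rule N.square_integrable_imp_integrable[OF Ym[OF that] sq[OF that]])
  have cov: "(\<integral>\<omega>. Y s \<omega> * Y t \<omega> \<partial>N) = (\<integral>x. centered s x * centered t x \<partial>\<mu>)"
    if "s \<in> {a..b}" "t \<in> {a..b}" for s t
  proof -
    have "covariance N (Y s) (Y t) = (\<integral>x. centered s x * centered t x \<partial>\<mu>)"
      using Y that unfolding centered_gaussian_process_def by blast
    then show ?thesis unfolding covariance_def using Y0 that by simp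
  qed
  let ?S = "\<lambda>\<omega>. \<Sum>t\<in>F. c t * Y t \<omega>"
  have Sm: "?S \<in> borel_measurable N"
    by (intro borel_measurable_sum borel_measurable_times borel_measurable_const Ym T)
  obtain m v where mv: "0 \<le> v" "distr N borel ?S = normal_law m v" using Yn[OF F] by blast
  have "m = (\<integral>x. x \<partial>distr N borel ?S)" using mean_normal_law[of m v] mv(2) by simp
  also have "\<dots> = (\<integral>\<omega>. ?S \<omega> \<partial>N)" by (rule integral_distr[OF Sm]) simp
  also have "\<dots> = 0" using Yi[OF T] Y0[OF T] by simp
  finally have m: "m = 0" .
  have "v = (\<integral>x. x\<^sup>2 \<partial>distr N borel ?S)"
    using second_moment_centered_normal_law[OF mv(1)] mv(2) m by simp
  also have "\<dots> = (\<integral>\<omega>. (?S \<omega>)\<^sup>2 \<partial>N)" by (rule integral_distr[OF Sm]) simp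
  also have "\<dots> = (\<Sum>s\<in>F. \<Sum>t\<in>F. c s * c t * (\<integral>\<omega>. Y s \<omega> * Y t \<omega> \<partial>N))"
    by (rule integral_square_linear_combination) (use Ym[OF T] sq[OF T] in auto)
  also have "\<dots> = (\<Sum>s\<in>F. \<Sum>t\<in>F. c s * c t * (\<integral>x. centered s x * centered t x \<partial>\<mu>))"
    using cov T by (intro sum.cong refl) auto
  also have "\<dots> = (\<integral>x. (\<Sum>t\<in>F. c t * centered t x)\<^sup>2 \<partial>\<mu>)"
    by (rule linear_combination_centered(4)[OF F, symmetric])
  finally show "distr N borel ?S = normal_law 0 (\<integral>x. (\<Sum>t\<in>F. c t * centered t x)\<^sup>2 \<partial>\<mu>)"
    using mv(2) m by simp
qed

text \<open>The minimum over \<open>F\<close> is a Lipschitz function of the coordinates, so that the Cramer-Wold argument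
  applies.\<close>

lemma finite_minimum_limit:
  fixes \<psi> :: "real \<Rightarrow> real"
  assumes Y: "centered_gaussian_process N {a..b} (\<lambda>s t. \<integral>x. centered s x * centered t x \<partial>\<mu>) Y"
    and F: "finite F" "F \<noteq> {}" "F \<subseteq> {a..b}"
    and lip: "\<And>x y. \<bar>\<psi> x - \<psi> y\<bar> \<le> L * \<bar>x - y\<bar>" and bdd: "\<And>x. \<bar>\<psi> x\<bar> \<le> B"
  shows "(\<lambda>n. \<integral>\<omega>. \<psi> (MIN t\<in>F. G n t \<omega>) \<partial>M) \<longlonglongrightarrow> (\<integral>\<omega>. \<psi> (MIN t\<in>F. Y t \<omega>) \<partial>N)"
proof -
  have N: "prob_space N" using Y by (simp add: centered_gaussian_process_def)
  have T: "t \<in> {a..b}" if "t \<in> F" for t using that F(3) by blast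
  have Ym: "Y t \<in> borel_measurable N" if "t \<in> F" for t
    using Y T[OF that] by (simp add: centered_gaussian_process_def)
  have Gm: "G n t \<in> borel_measurable M" if "t \<in> F" for n t using G_measurable[OF T[OF that]] .
  have L: "0 \<le> L" using order_trans[OF abs_ge_zero lip[of 0 1]] by simp
  have \<psi>m [measurable]: "\<psi> \<in> borel_measurable borel"
    using lip by (rule borel_measurable_if_Lipschitz)
  define g where "g x = \<psi> (MIN t\<in>F. x t)" for x :: "real \<Rightarrow> real"
  have "(\<lambda>n. \<integral>\<omega>. g (\<lambda>t. G n t \<omega>) \<partial>M) \<longlonglongrightarrow> (\<integral>\<omega>. g (\<lambda>t. Y t \<omega>) \<partial>N)"
  proof (rule Cramer_Wold_Lipschitz[where A = G and B = Y and g = g and L = L and C = B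
        and V = "\<lambda>t. \<integral>x. (centered t x)\<^sup>2 \<partial>\<mu>", OF prob_space_axioms N F(1)])
    show "integrable M (\<lambda>\<omega>. (G n t \<omega>)\<^sup>2)" if "t \<in> F" for n t
      unfolding G_def using T[OF that]
      by (intro integrable_square_normalized_sum centered_measurable centered_square)
    show "(\<integral>\<omega>. (G n t \<omega>)\<^sup>2 \<partial>M) \<le> (\<integral>x. (centered t x)\<^sup>2 \<partial>\<mu>)" if "t \<in> F" for n t
      unfolding G_def using T[OF that]
      by (intro second_moment_normalized_sum centered_measurable centered_square centered_mean)
    show "integrable N (\<lambda>\<omega>. (Y t \<omega>)\<^sup>2)" if "t \<in> F" for t
      by (rule gaussian_linear_combination_law(2)[OF Y F(1,3) T[OF that]])
    show "(\<lambda>n. \<integral>\<omega>. cos ((\<Sum>t\<in>F. c t * G n t \<omega>) + d) \<partial>M)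
        \<longlonglongrightarrow> (\<integral>\<omega>. cos ((\<Sum>t\<in>F. c t * Y t \<omega>) + d) \<partial>N)" for c d
    proof -
      have "(\<lambda>\<omega>. \<Sum>t\<in>F. c t * Y t \<omega>) \<in> borel_measurable N"
        by (intro borel_measurable_sum borel_measurable_times borel_measurable_const Ym)
      then have "(\<integral>\<omega>. cos ((\<Sum>t\<in>F. c t * Y t \<omega>) + d) \<partial>N)
          = (\<integral>x. cos (x + d) \<partial>distr N borel (\<lambda>\<omega>. \<Sum>t\<in>F. c t * Y t \<omega>))"
        by (rule integral_distr[symmetric]) simp
      then show ?thesis
        unfolding linear_combination_G gaussian_linear_combination_law(1)[OF Y F(1,3)]
        using normalized_sum_CLT[OF linear_combination_centered(1-3)[OF F(1,3)],
            where f = "\<lambda>x. cos (x + d)" and B = 1]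
        by simp
    qed
    show "\<bar>g x - g y\<bar> \<le> L * (\<Sum>t\<in>F. \<bar>x t - y t\<bar>)" for x y
    proof -
      have "\<bar>g x - g y\<bar> \<le> L * \<bar>(MIN t\<in>F. x t) - (MIN t\<in>F. y t)\<bar>" unfolding g_def by (rule lip)
      also have "\<dots> \<le> L * (\<Sum>t\<in>F. \<bar>x t - y t\<bar>)"
        by (intro mult_left_mono Min_image_diff_le_sum F L)
      finally show ?thesis .
    qed
    show "\<bar>g x\<bar> \<le> B" for x unfolding g_def by (rule bdd)
    show "(\<lambda>\<omega>. g (\<lambda>t. G n t \<omega>)) \<in> borel_measurable M" for n
      unfolding g_def by (intro measurable_compose[OF _ \<psi>m] borel_measurable_Min F(1) Gm)
    show "(\<lambda>\<omega>. g (\<lambda>t. Y t \<omega>)) \<in> borel_measurable N"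
      unfolding g_def by (intro measurable_compose[OF _ \<psi>m] borel_measurable_Min F(1) Ym)
  qed (use Gm Ym L in auto)
  then show ?thesis unfolding g_def .
qed

context
  fixes f :: "real \<Rightarrow> real" and v :: real and Z :: "nat \<Rightarrow> 'a \<Rightarrow> real"
  assumes f: "continuous_on {a..b} f" and min: "\<And>t. t \<in> {a..b} \<Longrightarrow> v \<le> f t"
    and Z: "\<And>n. Z n \<in> borel_measurable M"
    and Z_eq: "\<And>n. 0 < n \<Longrightarrow>
      AE \<omega> in M. Z n \<omega> = sqrt n * ((INF t\<in>{a..b}. f t + G n t \<omega> / sqrt n) - v)"
begin

text \<open>Piecewise linear approximations of half-line indicators are Lipschitz and determine weak convergence.
  For them the minima over finer and finer nets of \<open>S\<close> converge to the infimum over \<open>S\<close>, path by path,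
  and dominated convergence applies. The variable \<open>Z n\<close> is tied to the scaled gap only almost surely,
  because on a null set the sample losses may be infinite.\<close>

theorem scaled_gap_weak_limit:
  assumes S: "S = {t\<in>{a..b}. f t = v}" "compact S" "S \<noteq> {}"
    and Y: "centered_gaussian_process N {a..b} (\<lambda>s t. \<integral>x. centered s x * centered t x \<partial>\<mu>) Y"
  shows "weak_conv_m (\<lambda>n. distr M borel (Z n)) (distr N borel (\<lambda>\<omega>. INF t\<in>S. Y t \<omega>))"
proof -
  interpret N: prob_space N using Y by (simp add: centered_gaussian_process_def)
  from compact_finite_nets[OF S(2,3)] obtain F where "\<forall>k. finite (F k) \<and> F k \<noteq> {} \<and> F k \<subseteq> S \<and>
      (\<forall>s\<in>S. \<exists>t\<in>F k. \<bar>s - t\<bar> < 1 / real (Suc k))"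
    by (rule exE)
  then have F: "finite (F k)" "F k \<noteq> {}" "F k \<subseteq> S" "\<And>s. s \<in> S \<Longrightarrow> \<exists>t\<in>F k. \<bar>s - t\<bar> < 1 / real (Suc k)" for k
    by auto
  have ST: "S \<subseteq> {a..b}" using S(1) by blast
  have Ycont: "continuous_on S (\<lambda>t. Y t \<omega>)" if "\<omega> \<in> space N" for \<omega>
    by (rule continuous_on_subset[OF _ ST]) (use Y that in \<open>simp add: centered_gaussian_process_def\<close>)
  have Ym: "Y t \<in> borel_measurable N" if "t \<in> F k" for t k
  proof -
    have "t \<in> {a..b}" using that F(3)[of k] ST by blast
    then show ?thesis using Y by (simp add: centered_gaussian_process_def)
  qed
  have lim: "(\<lambda>k. MIN t\<in>F k. Y t \<omega>) \<longlonglongrightarrow> (INF t\<in>S. Y t \<omega>)" if "\<omega> \<in> space N" for \<omega>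
    by (rule Min_nets_tendsto_INF[OF S(2,3) Ycont[OF that] F])
  have minm: "(\<lambda>\<omega>. MIN t\<in>F k. Y t \<omega>) \<in> borel_measurable N" for k
    by (rule borel_measurable_Min[OF F(1) Ym])
  have infm [measurable]: "(\<lambda>\<omega>. INF t\<in>S. Y t \<omega>) \<in> borel_measurable N"
    by (rule borel_measurable_LIMSEQ_real[OF lim minm])
  show ?thesis
  proof (rule integral_cts_step_conv_imp_weak_conv)
    show "real_distribution (distr M borel (Z n))" for n by (rule real_distribution_distr[OF Z])
    show "real_distribution (distr N borel (\<lambda>\<omega>. INF t\<in>S. Y t \<omega>))"
      by (rule N.real_distribution_distr) simp
    fix x y :: real assume xy: "x < y"
    note lip = cts_step_Lipschitz[OF xy] and bdd = abs_cts_step_le_one[OF xy]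
    have cm [measurable]: "cts_step x y \<in> borel_measurable borel"
      using lip by (rule borel_measurable_if_Lipschitz)
    have "(\<lambda>k. \<integral>\<omega>. cts_step x y (MIN t\<in>F k. Y t \<omega>) \<partial>N) \<longlonglongrightarrow> (\<integral>\<omega>. cts_step x y (INF t\<in>S. Y t \<omega>) \<partial>N)"
    proof (rule integral_dominated_convergence[where w = "\<lambda>_. 1"])
      show "(\<lambda>\<omega>. cts_step x y (MIN t\<in>F k. Y t \<omega>)) \<in> borel_measurable N" for k
        by (rule measurable_compose[OF minm cm])
      show "AE \<omega> in N. (\<lambda>k. cts_step x y (MIN t\<in>F k. Y t \<omega>)) \<longlonglongrightarrow> cts_step x y (INF t\<in>S. Y t \<omega>)"
        by (intro AE_I2 isCont_tendsto_compose[OF isCont_if_Lipschitz[OF lip]] lim)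
    qed (use bdd in auto)
    moreover have "(\<lambda>n. \<integral>\<omega>. cts_step x y (MIN t\<in>F k. G n t \<omega>) \<partial>M)
        \<longlonglongrightarrow> (\<integral>\<omega>. cts_step x y (MIN t\<in>F k. Y t \<omega>) \<partial>N)" for k
      by (rule finite_minimum_limit[OF Y F(1) F(2) order_trans[OF F(3) ST] lip bdd])
    ultimately have "(\<lambda>n. \<integral>\<omega>. cts_step x y (Z n \<omega>) \<partial>M) \<longlonglongrightarrow> (\<integral>\<omega>. cts_step x y (INF t\<in>S. Y t \<omega>) \<partial>N)"
    proof (intro scaled_gap_test_function_limit[where f = f and v = v and F = F and \<psi> = "cts_step x y"
          and Z = Z and L = "1 / (y - x)" and B = 1
          and I = "\<lambda>k. \<integral>\<omega>. cts_step x y (MIN t\<in>F k. Y t \<omega>) \<partial>N"])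
    qed (rule f min Z Z_eq F[unfolded S(1)] lip bdd | assumption)+
    then show "(\<lambda>n. \<integral>z. cts_step x y z \<partial>distr M borel (Z n))
        \<longlonglongrightarrow> (\<integral>z. cts_step x y z \<partial>distr N borel (\<lambda>\<omega>. INF t\<in>S. Y t \<omega>))"
      by (simp add: integral_distr Z)
  qed
qed

theorem scaled_gap_weak_limit_singleton:
  assumes S: "{t\<in>{a..b}. f t = v} = {t0}"
  shows "weak_conv_m (\<lambda>n. distr M borel (Z n)) (normal_law 0 (\<integral>x. (centered t0 x)\<^sup>2 \<partial>\<mu>))"
proof (rule integral_cts_step_conv_imp_weak_conv)
  have t0: "t0 \<in> {a..b}" "f t0 = v" using S by auto
  show "real_distribution (distr M borel (Z n))" for n by (rule real_distribution_distr[OF Z])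
  show "real_distribution (normal_law 0 (\<integral>x. (centered t0 x)\<^sup>2 \<partial>\<mu>))"
    by (rule real_distribution_normal_law)
  fix x y :: real assume xy: "x < y"
  note lip = cts_step_Lipschitz[OF xy] and bdd = abs_cts_step_le_one[OF xy]
  have cm [measurable]: "cts_step x y \<in> borel_measurable borel"
    using lip by (rule borel_measurable_if_Lipschitz)
  have clt: "(\<lambda>n. \<integral>\<omega>. cts_step x y (MIN s\<in>{t0}. G n s \<omega>) \<partial>M)
      \<longlonglongrightarrow> (\<integral>z. cts_step x y z \<partial>normal_law 0 (\<integral>x. (centered t0 x)\<^sup>2 \<partial>\<mu>))"
    unfolding G_def
    using normalized_sum_CLT[OF centered_measurable[OF t0(1)] centered_square[OF t0(1)] centered_mean[OF t0(1)]
        isCont_if_Lipschitz[OF lip] bdd]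
    by simp
  have "(\<lambda>n. \<integral>\<omega>. cts_step x y (Z n \<omega>) \<partial>M)
      \<longlonglongrightarrow> (\<integral>z. cts_step x y z \<partial>normal_law 0 (\<integral>x. (centered t0 x)\<^sup>2 \<partial>\<mu>))"
  proof (rule scaled_gap_test_function_limit[where f = f and v = v and F = "\<lambda>_. {t0}"
        and \<psi> = "cts_step x y" and Z = Z and L = "1 / (y - x)" and B = 1 and I = "\<lambda>_. \<integral>z. cts_step x y z \<partial>normal_law 0 (\<integral>x. (centered t0 x)\<^sup>2 \<partial>\<mu>)"])
    show "{t0} \<subseteq> {t\<in>{a..b}. f t = v}" using S by simp
    show "\<exists>t\<in>{t0}. \<bar>s - t\<bar> < 1 / real (Suc k)" if "s \<in> {t\<in>{a..b}. f t = v}" for k s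
      using that unfolding S by simp
  qed (rule f min Z Z_eq lip bdd clt tendsto_const finite.intros insert_not_empty | assumption)+
  then show "(\<lambda>n. \<integral>z. cts_step x y z \<partial>distr M borel (Z n))
      \<longlonglongrightarrow> (\<integral>z. cts_step x y z \<partial>normal_law 0 (\<integral>x. (centered t0 x)\<^sup>2 \<partial>\<mu>))"
    by (simp add: integral_distr Z)
qed

end

end

section \<open>The loss function and the OCE objective\<close>

lemma loss_of_mono: "utility u \<Longrightarrow> mono (loss_of u)"
  unfolding utility_def loss_of_def mono_def by simp

lemma loss_of_ge: "utility u \<Longrightarrow> ereal z \<le> loss_of u z"
proof -
  assume "utility u"
  \<comment> \<open>The slope \<open>1\<close> is a supergradient of \<open>u\<close> at \<open>0\<close>, and \<open>u 0 = 0\<close>.\<close>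
  then have "u (- z) \<le> ereal (- z)"
    unfolding utility_def concave_subdifferential_def by auto
  then have "- ereal (- z) \<le> - u (- z)" by (simp only: ereal_minus_le_minus)
  then show ?thesis unfolding loss_of_def by simp
qed

lemma loss_of_convex:
  assumes u: "utility u" and p: "loss_of u x = ereal p" and q: "loss_of u y = ereal q"
    and w: "0 \<le> w" "w \<le> 1"
  shows "loss_of u ((1 - w) * x + w * y) \<le> ereal ((1 - w) * p + w * q)"
proof -
  have "convex (hypograph u)" using u by (simp add: utility_def proper_concave_def)
  moreover have "u (- x) = ereal (- p)" "u (- y) = ereal (- q)"
    using p q by (simp_all add: loss_of_def ereal_uminus_eq_reorder)
  then have "(- x, - p) \<in> hypograph u" "(- y, - q) \<in> hypograph u" by (simp_all add: hypograph_def)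
  ultimately have "(1 - w) *\<^sub>R (- x, - p) + w *\<^sub>R (- y, - q) \<in> hypograph u"
    using w by (intro convexD_alt)
  then have "ereal (- ((1 - w) * p + w * q)) \<le> u (- ((1 - w) * x + w * y))"
    by (simp add: hypograph_def algebra_simps)
  then have "- u (- ((1 - w) * x + w * y)) \<le> - ereal (- ((1 - w) * p + w * q))"
    by (simp only: ereal_minus_le_minus)
  then show ?thesis by (simp add: loss_of_def add.commute)
qed

text \<open>The sublevel sets of the loss are sections of the reflected hypograph of \<open>u\<close>, hence closed.\<close>

lemma loss_of_measurable:
  assumes u: "utility u" shows "loss_of u \<in> borel_measurable borel"
  unfolding borel_measurable_iff_Iic_ereal
proof
  fix c :: ereal
  show "loss_of u -` {..c} \<inter> space borel \<in> sets borel"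
  proof (cases c)
    case (real r)
    have "closed (hypograph u)" using u by (simp add: utility_def)
    then have "closed ((\<lambda>z. (- z, - r)) -` hypograph u)"
      by (rule closed_vimage) (intro continuous_intros)
    moreover have "loss_of u -` {..c} = (\<lambda>z. (- z, - r)) -` hypograph u"
      unfolding real loss_of_def hypograph_def by (auto simp: ereal_uminus_le_reorder)
    ultimately show ?thesis by simp
  next
    case MInf
    have "loss_of u z \<noteq> - \<infinity>" for z using loss_of_ge[OF u, of z] by auto
    then have "loss_of u -` {..c} = {}" unfolding MInf by auto
    then show ?thesis by simp
  next
    case PInf
    have "loss_of u -` {..c} = UNIV" unfolding PInf by auto
    then show ?thesis by simp
  qed
qed

text \<open>Moving \<open>t\<close> to a rational point slightly to its right increases the objective by at most the
  displacement, because the losses \<open>l (x i - t)\<close> decrease in \<open>t\<close>. The right endpoint must be kept, since the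
  objective may be infinite everywhere else.\<close>

lemma saa_value_countable:
  assumes l: "mono l" and ab: "a \<le> b"
  shows "saa_value l n x {a..b} = (INF t\<in>insert b (\<rat> \<inter> {a..b}). saa_objective l n x t)"
proof (rule antisym)
  show "saa_value l n x {a..b} \<le> (INF t\<in>insert b (\<rat> \<inter> {a..b}). saa_objective l n x t)"
    unfolding saa_value_def using ab by (intro INF_superset_mono) auto
  show "(INF t\<in>insert b (\<rat> \<inter> {a..b}). saa_objective l n x t) \<le> saa_value l n x {a..b}"
    unfolding saa_value_def
  proof (rule INF_greatest)
    fix t assume t: "t \<in> {a..b}"
    show "(INF t\<in>insert b (\<rat> \<inter> {a..b}). saa_objective l n x t) \<le> saa_objective l n x t"
    proof (cases "t = b")
      case False
      show ?thesis
      proof (rule ereal_le_epsilon2)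
        fix e :: real assume e: "0 < e"
        obtain q where q: "q \<in> \<rat>" "t < q" "q < min b (t + e)"
          using Rats_dense_in_real[of t "min b (t + e)"] False t e by auto
        have "saa_objective l n x q \<le> ereal (t + e) + ereal (1 / real n) * (\<Sum>i<n. l (x i - t))"
          unfolding saa_objective_def using q l
          by (intro add_mono ereal_mult_left_mono sum_mono) (auto intro: monoD)
        also have "\<dots> = saa_objective l n x t + ereal e"
          unfolding saa_objective_def plus_ereal.simps(1)[symmetric] by (simp only: ac_simps)
        finally show "(INF t\<in>insert b (\<rat> \<inter> {a..b}). saa_objective l n x t) \<le> saa_objective l n x t + ereal e"
          using q t by (intro INF_lower2[of q]) auto
      qed
    qed (auto intro: INF_lower)
  qed
qed

lemma saa_value_measurable:
  assumes l: "mono l" "l \<in> borel_measurable borel" and ab: "a \<le> b"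
    and X [measurable]: "\<And>i. X i \<in> borel_measurable M"
  shows "(\<lambda>\<omega>. saa_value l n (\<lambda>i. X i \<omega>) {a..b}) \<in> borel_measurable M"
proof -
  have "(\<lambda>\<omega>. l (X i \<omega> - t)) \<in> borel_measurable M" for i t
    by (rule measurable_compose[OF _ l(2)]) simp
  then have "(\<lambda>\<omega>. saa_objective l n (\<lambda>i. X i \<omega>) t) \<in> borel_measurable M" for t
    unfolding saa_objective_def by simp
  then show ?thesis unfolding saa_value_countable[OF l(1) ab]
    by (intro borel_measurable_INF) (auto intro: countable_Int1 countable_rat)
qed

text \<open>Enclose \<open>[s, t]\<close> in a slightly larger interval with endpoints in \<open>D\<close>; monotonicity transfers the bound
  from there. The endpoints \<open>a\<close> and \<open>b\<close> belong to \<open>D\<close> so that such an enclosure exists.\<close>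

lemma antimono_Lipschitz_if_on_rationals:
  fixes g :: "real \<Rightarrow> real"
  assumes anti: "\<And>s t. s \<in> {a..b} \<Longrightarrow> t \<in> {a..b} \<Longrightarrow> s \<le> t \<Longrightarrow> g t \<le> g s"
    and D: "D = insert a (insert b (\<rat> \<inter> {a..b}))"
    and lip: "\<And>s t. s \<in> D \<Longrightarrow> t \<in> D \<Longrightarrow> \<bar>g s - g t\<bar> \<le> k * \<bar>s - t\<bar>"
    and st: "s \<in> {a..b}" "t \<in> {a..b}"
  shows "\<bar>g s - g t\<bar> \<le> k * \<bar>s - t\<bar>"
proof -
  have main: "\<bar>g s - g t\<bar> \<le> k * \<bar>s - t\<bar>" if st: "s \<in> {a..b}" "t \<in> {a..b}" "s < t" for s t
  proof -
    have "a < b" using st by auto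
    have "0 \<le> k * \<bar>a - b\<bar>" using lip[of a b] D by (intro order_trans[OF abs_ge_zero]) auto
    then have k: "0 \<le> k" using \<open>a < b\<close> by (simp add: zero_le_mult_iff)
    have "g s - g t \<le> k * (t - s)"
    proof (rule field_le_epsilon)
      fix e :: real assume e: "0 < e"
      define d where "d = e / (2 * (k + 1))"
      have d: "0 < d" unfolding d_def using e k by simp
      have kd: "k * (2 * d) \<le> e" unfolding d_def using e k by (simp add: field_simps)
      obtain q where q: "q \<in> D" "q \<le> s" "s - d \<le> q"
      proof (cases "s - d < a")
        case True then show ?thesis using that[of a] D st by auto
      next
        case False
        obtain q where "q \<in> \<rat>" "s - d < q" "q < s" using Rats_dense_in_real[of "s - d" s] d by auto
        then show ?thesis using that[of q] D st False by auto
      qed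
      obtain r where r: "r \<in> D" "t \<le> r" "r \<le> t + d"
      proof (cases "b < t + d")
        case True then show ?thesis using that[of b] D st by auto
      next
        case False
        obtain q where "q \<in> \<rat>" "t < q" "q < t + d" using Rats_dense_in_real[of t "t + d"] d by auto
        then show ?thesis using that[of q] D st False by auto
      qed
      have D_ab: "D \<subseteq> {a..b}" using D \<open>a < b\<close> by auto
      have "g s \<le> g q" "g r \<le> g t" using anti q r D_ab st by blast+
      moreover have "g q - g r \<le> k * \<bar>q - r\<bar>" using lip[OF q(1) r(1)] by linarith
      moreover have "k * \<bar>q - r\<bar> \<le> k * (t - s + 2 * d)"
        using q r st k by (intro mult_left_mono) auto
      moreover have "k * (t - s + 2 * d) \<le> k * (t - s) + e" using kd by (simp add: distrib_left)
      ultimately show "g s - g t \<le> k * (t - s) + e" by linarith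
    qed
    moreover have "g t \<le> g s" using anti st by auto
    ultimately show ?thesis using st by simp
  qed
  show ?thesis using main[of s t] main[of t s] st
    by (cases s t rule: linorder_cases) (auto simp: abs_minus_commute)
qed

text \<open>The hypotheses on a single copy of the loss variable, with a fixed Lipschitz modulus \<open>K\<close>.\<close>

locale oce_problem = P: prob_space P for P :: "'b measure" +
  fixes u l :: "real \<Rightarrow> ereal" and \<xi> :: "'b \<Rightarrow> real" and K :: "real \<Rightarrow> real" and a b :: real
  assumes u: "utility u" and l: "l = loss_of u"
    and \<xi> [measurable]: "\<xi> \<in> borel_measurable P" and ab: "a \<le> b"
    and square_bound: "(SUP t\<in>{a..b}. \<integral>\<^sup>+ \<omega>. e2ennreal ((l (\<xi> \<omega> - t))\<^sup>2) \<partial>P) < \<infinity>"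
    and K_measurable [measurable]: "K \<in> borel_measurable borel"
    and K_square: "integrable P (\<lambda>\<omega>. (K (\<xi> \<omega>))\<^sup>2)"
    and K_Lipschitz: "\<And>s t. s \<in> {a..b} \<Longrightarrow> t \<in> {a..b} \<Longrightarrow>
      AE \<omega> in P. \<bar>l (\<xi> \<omega> - s) - l (\<xi> \<omega> - t)\<bar> \<le> ereal (K (\<xi> \<omega>) * \<bar>s - t\<bar>)"
begin

definition \<mu> :: "real measure" where "\<mu> = distr P borel \<xi>"

definition h :: "real \<Rightarrow> real \<Rightarrow> real" where "h t x = real_of_ereal (l (x - t))"

definition f :: "real \<Rightarrow> real" where "f t = t + (\<integral>x. h t x \<partial>\<mu>)"

lemma l_measurable [measurable]: "l \<in> borel_measurable borel"
  unfolding l by (rule loss_of_measurable[OF u])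

lemma l_mono: "mono l"
  unfolding l by (rule loss_of_mono[OF u])

lemma h_measurable [measurable]: "h t \<in> borel_measurable borel"
  unfolding h_def[abs_def] by measurable

text \<open>The parameter \<open>a\<close> gives the largest loss, so that finiteness there implies finiteness on \<open>[a, b]\<close>.\<close>

lemma loss_eq_h:
  assumes "l (x - a) \<noteq> \<infinity>" "t \<in> {a..b}" shows "l (x - t) = ereal (h t x)"
proof -
  have "l (x - t) \<le> l (x - a)" using assms(2) by (intro monoD[OF l_mono]) simp
  then have "l (x - t) \<noteq> \<infinity>" using assms(1) by auto
  moreover have "l (x - t) \<noteq> - \<infinity>" using loss_of_ge[OF u, of "x - t"] unfolding l by auto
  ultimately show ?thesis unfolding h_def by (auto simp: ereal_real)
qed

lemma square_finite: "t \<in> {a..b} \<Longrightarrow> (\<integral>\<^sup>+ \<omega>. e2ennreal ((l (\<xi> \<omega> - t))\<^sup>2) \<partial>P) < \<infinity>"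
  using square_bound by (rule le_less_trans[rotated]) (intro SUP_upper)

lemma AE_loss_finite: "AE \<omega> in P. l (\<xi> \<omega> - a) \<noteq> \<infinity>"
proof -
  have "(\<lambda>\<omega>. e2ennreal ((l (\<xi> \<omega> - a))\<^sup>2)) \<in> borel_measurable P"
    unfolding power2_eq_square by measurable
  then have "AE \<omega> in P. e2ennreal ((l (\<xi> \<omega> - a))\<^sup>2) \<noteq> \<infinity>"
    using square_finite[of a] ab by (intro nn_integral_PInf_AE) auto
  then show ?thesis
  proof eventually_elim
    case (elim \<omega>)
    then show ?case by (cases "l (\<xi> \<omega> - a)") auto
  qed
qed

lemma AE_loss_eq_h: "t \<in> {a..b} \<Longrightarrow> AE \<omega> in P. l (\<xi> \<omega> - t) = ereal (h t (\<xi> \<omega>))"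
  using AE_loss_finite by eventually_elim (rule loss_eq_h)

lemma AE_law_iff: "Measurable.pred borel Q \<Longrightarrow> (AE x in \<mu>. Q x) \<longleftrightarrow> (AE \<omega> in P. Q (\<xi> \<omega>))"
  unfolding \<mu>_def by (rule AE_distr_iff) (auto simp: pred_def)

lemma AE_law_finite: "AE x in \<mu>. l (x - a) \<noteq> \<infinity>"
  by (subst AE_law_iff) (use AE_loss_finite in simp_all)

lemma integral_law: "w \<in> borel_measurable borel \<Longrightarrow> (\<integral>x. w x \<partial>\<mu>) = (\<integral>\<omega>. w (\<xi> \<omega>) \<partial>P)" for w :: "real \<Rightarrow> real"
  unfolding \<mu>_def by (rule integral_distr[OF \<xi>])

lemma integrable_law: "w \<in> borel_measurable borel \<Longrightarrow> integrable \<mu> w \<longleftrightarrow> integrable P (\<lambda>\<omega>. w (\<xi> \<omega>))" for w :: "real \<Rightarrow> real"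
  unfolding \<mu>_def by (rule integrable_distr_eq[OF \<xi>])

lemma h_square_P:
  assumes t: "t \<in> {a..b}" shows "integrable P (\<lambda>\<omega>. (h t (\<xi> \<omega>))\<^sup>2)"
proof (rule integrableI_nonneg)
  have "(\<integral>\<^sup>+ \<omega>. ennreal ((h t (\<xi> \<omega>))\<^sup>2) \<partial>P) = (\<integral>\<^sup>+ \<omega>. e2ennreal ((l (\<xi> \<omega> - t))\<^sup>2) \<partial>P)"
    using AE_loss_eq_h[OF t]
    by (intro nn_integral_cong_AE, eventually_elim) (simp add: e2ennreal_ereal)
  then show "(\<integral>\<^sup>+ \<omega>. ennreal ((h t (\<xi> \<omega>))\<^sup>2) \<partial>P) < \<infinity>" using square_finite[OF t] by simp
qed auto

lemma h_integrable_P: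
  assumes t: "t \<in> {a..b}" shows "integrable P (\<lambda>\<omega>. h t (\<xi> \<omega>))"
  by (rule P.square_integrable_imp_integrable[OF _ h_square_P[OF t]]) measurable

lemma h_Lipschitz: "AE x in \<mu>. \<forall>s\<in>{a..b}. \<forall>t\<in>{a..b}. \<bar>h s x - h t x\<bar> \<le> K x * \<bar>s - t\<bar>"
proof -
  define D where "D = insert a (insert b (\<rat> \<inter> {a..b}))"
  have D: "countable D" "D \<subseteq> {a..b}" unfolding D_def using ab by (auto intro: countable_Int1 countable_rat)
  have "AE x in \<mu>. \<bar>h s x - h t x\<bar> \<le> K x * \<bar>s - t\<bar>" if "s \<in> {a..b}" "t \<in> {a..b}" for s t
  proof (subst AE_law_iff)
    show "AE \<omega> in P. \<bar>h s (\<xi> \<omega>) - h t (\<xi> \<omega>)\<bar> \<le> K (\<xi> \<omega>) * \<bar>s - t\<bar>"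
      using AE_loss_eq_h[OF that(1)] AE_loss_eq_h[OF that(2)] K_Lipschitz[OF that]
      by eventually_elim simp
  qed measurable
  then have "AE x in \<mu>. \<forall>s\<in>D. \<forall>t\<in>D. \<bar>h s x - h t x\<bar> \<le> K x * \<bar>s - t\<bar>"
    using D(2) by (subst AE_ball_countable[OF D(1)], intro ballI, subst AE_ball_countable[OF D(1)]) blast
  with AE_law_finite show ?thesis
  proof eventually_elim
    case (elim x)
    have anti: "h t x \<le> h s x" if "s \<in> {a..b}" "t \<in> {a..b}" "s \<le> t" for s t
    proof -
      have "l (x - t) \<le> l (x - s)" using that(3) by (intro monoD[OF l_mono]) simp
      then show ?thesis using loss_eq_h[OF elim(1)] that by simp
    qed
    show ?case
    proof (intro ballI)
      fix s t assume st: "s \<in> {a..b}" "t \<in> {a..b}"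
      show "\<bar>h s x - h t x\<bar> \<le> K x * \<bar>s - t\<bar>"
        by (rule antimono_Lipschitz_if_on_rationals[where g = "\<lambda>t. h t x", OF anti D_def _ st])
           (use elim(2) in auto)
    qed
  qed
qed

lemma oce_objective_eq:
  assumes t: "t \<in> {a..b}" shows "oce_objective l P \<xi> t = ereal (f t)"
proof -
  have int: "integrable P (\<lambda>\<omega>. h t (\<xi> \<omega>))" by (rule h_integrable_P[OF t])
  have "(\<integral>\<^sup>+ \<omega>. e2ennreal (l (\<xi> \<omega> - t)) \<partial>P) = (\<integral>\<^sup>+ \<omega>. ennreal (h t (\<xi> \<omega>)) \<partial>P)"
    using AE_loss_eq_h[OF t]
    by (intro nn_integral_cong_AE, eventually_elim) (simp add: e2ennreal_ereal)
  moreover have "(\<integral>\<^sup>+ \<omega>. e2ennreal (- l (\<xi> \<omega> - t)) \<partial>P) = (\<integral>\<^sup>+ \<omega>. ennreal (- h t (\<xi> \<omega>)) \<partial>P)"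
    using AE_loss_eq_h[OF t]
    by (intro nn_integral_cong_AE, eventually_elim) (simp add: e2ennreal_ereal)
  moreover have "(\<integral>\<^sup>+ \<omega>. ennreal (h t (\<xi> \<omega>)) \<partial>P) \<noteq> \<infinity>" "(\<integral>\<^sup>+ \<omega>. ennreal (- h t (\<xi> \<omega>)) \<partial>P) \<noteq> \<infinity>"
    using int by (simp_all add: real_integrable_def)
  then have "enn2ereal (\<integral>\<^sup>+ \<omega>. ennreal (h t (\<xi> \<omega>)) \<partial>P) - enn2ereal (\<integral>\<^sup>+ \<omega>. ennreal (- h t (\<xi> \<omega>)) \<partial>P)
      = ereal (enn2real (\<integral>\<^sup>+ \<omega>. ennreal (h t (\<xi> \<omega>)) \<partial>P) - enn2real (\<integral>\<^sup>+ \<omega>. ennreal (- h t (\<xi> \<omega>)) \<partial>P))"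
    by (cases "\<integral>\<^sup>+ \<omega>. ennreal (h t (\<xi> \<omega>)) \<partial>P"; cases "\<integral>\<^sup>+ \<omega>. ennreal (- h t (\<xi> \<omega>)) \<partial>P")
       (simp_all add: enn2ereal_ennreal)
  ultimately have "ereal_expectation P (\<lambda>\<omega>. l (\<xi> \<omega> - t)) = ereal (\<integral>\<omega>. h t (\<xi> \<omega>) \<partial>P)"
    unfolding ereal_expectation_def real_lebesgue_integral_def[OF int] by simp
  then show ?thesis unfolding oce_objective_def f_def integral_law[OF h_measurable] by simp
qed

lemma f_convex:
  assumes st: "s \<in> {a..b}" "t \<in> {a..b}" and w: "0 \<le> w" "w \<le> 1"
  shows "f ((1 - w) * s + w * t) \<le> (1 - w) * f s + w * f t"
proof -
  let ?r = "(1 - w) * s + w * t"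
  have r: "?r \<in> {a..b}" using convexD_alt[OF convex_real_interval(5) st w] by simp
  have "(\<integral>\<omega>. h ?r (\<xi> \<omega>) \<partial>P) \<le> (\<integral>\<omega>. (1 - w) * h s (\<xi> \<omega>) + w * h t (\<xi> \<omega>) \<partial>P)"
  proof (rule integral_mono_AE)
    show "AE \<omega> in P. h ?r (\<xi> \<omega>) \<le> (1 - w) * h s (\<xi> \<omega>) + w * h t (\<xi> \<omega>)"
      using AE_loss_finite
    proof eventually_elim
      case (elim \<omega>)
      note eq = loss_eq_h[OF elim]
      have "l ((1 - w) * (\<xi> \<omega> - s) + w * (\<xi> \<omega> - t)) \<le> ereal ((1 - w) * h s (\<xi> \<omega>) + w * h t (\<xi> \<omega>))"
        unfolding l by (rule loss_of_convex[OF u]) (use eq st w l in auto)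
      moreover have "(1 - w) * (\<xi> \<omega> - s) + w * (\<xi> \<omega> - t) = \<xi> \<omega> - ?r" by (simp add: algebra_simps)
      ultimately show ?case using eq[OF r] by simp
    qed
  qed (use h_integrable_P st r in auto)
  also have "\<dots> = (1 - w) * (\<integral>\<omega>. h s (\<xi> \<omega>) \<partial>P) + w * (\<integral>\<omega>. h t (\<xi> \<omega>) \<partial>P)"
    using h_integrable_P st by simp
  finally show ?thesis unfolding f_def integral_law[OF h_measurable] by (simp add: algebra_simps)
qed

lemma loss_covariance_eq:
  "loss_covariance l P \<xi> = (\<lambda>s t. \<integral>x. (h s x - (\<integral>x. h s x \<partial>\<mu>)) * (h t x - (\<integral>x. h t x \<partial>\<mu>)) \<partial>\<mu>)"
  unfolding loss_covariance_def covariance_def h_def[symmetric] integral_law[OF h_measurable]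
  by (intro ext, subst integral_law) auto

lemma loss_variance_eq: "loss_variance l P \<xi> t = (\<integral>x. (h t x - (\<integral>x. h t x \<partial>\<mu>))\<^sup>2 \<partial>\<mu>)"
  unfolding loss_variance_def h_def[symmetric] integral_law[OF h_measurable]
  by (subst integral_law) auto

end

lemma oce_value_attained:
  assumes f: "continuous_on {a..b} f" and ab: "a \<le> b"
    and obj: "\<And>t. t \<in> {a..b} \<Longrightarrow> oce_objective l P \<xi> t = ereal (f t)"
  obtains v where "oce_value l P \<xi> {a..b} = ereal v" "\<And>t. t \<in> {a..b} \<Longrightarrow> v \<le> f t"
    "oce_solutions l P \<xi> {a..b} = {t \<in> {a..b}. f t = v}" "{t \<in> {a..b}. f t = v} \<noteq> {}"
proof -
  obtain t0 where t0: "t0 \<in> {a..b}" "\<And>t. t \<in> {a..b} \<Longrightarrow> f t0 \<le> f t"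
    using continuous_attains_inf[OF compact_Icc _ f] ab by auto
  have "oce_value l P \<xi> {a..b} = (INF t\<in>{a..b}. ereal (f t))"
    unfolding oce_value_def by (intro INF_cong refl obj)
  also have "\<dots> = ereal (f t0)"
    by (intro antisym INF_lower t0(1) INF_greatest) (simp add: t0(2))
  finally have val: "oce_value l P \<xi> {a..b} = ereal (f t0)" .
  have "oce_solutions l P \<xi> {a..b} = {t \<in> {a..b}. f t = f t0}"
    unfolding oce_solutions_def val using obj by auto
  then show ?thesis using that[of "f t0"] val t0 by blast
qed

section \<open>Asymptotics of the sample average optimal value\<close>

theorem proposition2:
  fixes u :: "real \<Rightarrow> ereal" and l :: "real \<Rightarrow> ereal"
    and P :: "'b measure" and \<xi> :: "'b \<Rightarrow> real"
    and M :: "'a measure" and X :: "nat \<Rightarrow> 'a \<Rightarrow> real"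
    and a b :: real and T S :: "real set"
  assumes "utility u"
    and "l = loss_of u"
    and "prob_space P" and "\<xi> \<in> borel_measurable P"
    and "a \<le> b" and "T = {a..b}"
    and "S = oce_solutions l P \<xi> T"
    and "prob_space M"
    and "prob_space.indep_vars M (\<lambda>_. borel) X UNIV"
    and "\<And>i. distr M borel (X i) = distr P borel \<xi>"
    and "(SUP t\<in>T. \<integral>\<^sup>+ \<omega>. e2ennreal ((l (\<xi> \<omega> - t))\<^sup>2) \<partial>P) < \<infinity>"
    and "\<exists>K :: real \<Rightarrow> real. K \<in> borel_measurable borel \<and>
           integrable P (\<lambda>\<omega>. (K (\<xi> \<omega>))\<^sup>2) \<and>
           (\<forall>t1\<in>T. \<forall>t2\<in>T. AE \<omega> in P.
              \<bar>l (\<xi> \<omega> - t1) - l (\<xi> \<omega> - t2)\<bar> \<le> ereal (K (\<xi> \<omega>) * \<bar>t1 - t2\<bar>))"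
  shows "(\<exists>tl tu. tl \<le> tu \<and> S = {tl..tu} \<and>
            (\<forall>(N :: 'c measure) Y.
               centered_gaussian_process N T (loss_covariance l P \<xi>) Y \<longrightarrow>
               weak_conv_m
                 (\<lambda>n. distr M borel (\<lambda>\<omega>. sqrt (real n) *
                    (real_of_ereal (saa_value l n (\<lambda>i. X i \<omega>) T) - real_of_ereal (oce_value l P \<xi> T))))
                 (distr N borel (\<lambda>\<omega>. INF t\<in>{tl..tu}. Y t \<omega>)))) \<and>
         (\<forall>t_star. S = {t_star} \<longrightarrow>
            weak_conv_m
              (\<lambda>n. distr M borel (\<lambda>\<omega>. sqrt (real n) *
                 (real_of_ereal (saa_value l n (\<lambda>i. X i \<omega>) T) - real_of_ereal (oce_value l P \<xi> T))))
              (normal_law 0 (loss_variance l P \<xi> t_star)))"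
proof -
  obtain K where K: "K \<in> borel_measurable borel" "integrable P (\<lambda>\<omega>. (K (\<xi> \<omega>))\<^sup>2)"
    "\<And>s t. s \<in> {a..b} \<Longrightarrow> t \<in> {a..b} \<Longrightarrow>
      AE \<omega> in P. \<bar>l (\<xi> \<omega> - s) - l (\<xi> \<omega> - t)\<bar> \<le> ereal (K (\<xi> \<omega>) * \<bar>s - t\<bar>)"
    using assms(12) unfolding \<open>T = {a..b}\<close> by blast
  interpret oce: oce_problem P u l \<xi> K a b
  proof (intro oce_problem.intro oce_problem_axioms.intro)
    show "(SUP t\<in>{a..b}. \<integral>\<^sup>+ \<omega>. e2ennreal ((l (\<xi> \<omega> - t))\<^sup>2) \<partial>P) < \<infinity>"
      using assms(11) unfolding \<open>T = {a..b}\<close> .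
  qed (fact assms K | rule K(3), assumption+)+
  interpret M: prob_space M by fact
  interpret smp: lipschitz_sample M X oce.\<mu> oce.h K a b
  proof (intro lipschitz_sample.intro lipschitz_sample_axioms.intro iid_sample.intro iid_sample_axioms.intro)
    show "distr M borel (X i) = oce.\<mu>" for i unfolding oce.\<mu>_def by (rule assms(10))
    show "integrable oce.\<mu> (\<lambda>x. (oce.h t x)\<^sup>2)" if "t \<in> {a..b}" for t
      using oce.h_square_P[OF that] by (subst oce.integrable_law) auto
    show "integrable oce.\<mu> (\<lambda>x. (K x)\<^sup>2)"
      using K(1,2) by (subst oce.integrable_law) auto
  qed (fact assms K(1) oce.h_Lipschitz | rule oce.h_measurable)+
  have f_eq: "oce.f t = t + smp.mean t" for t by (simp add: oce.f_def smp.mean_def)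
  have f_cont: "continuous_on {a..b} oce.f"
    unfolding f_eq[abs_def] by (intro continuous_on_add continuous_on_id smp.mean_continuous)
  obtain v where v: "oce_value l P \<xi> {a..b} = ereal v" "\<And>t. t \<in> {a..b} \<Longrightarrow> v \<le> oce.f t"
    "oce_solutions l P \<xi> {a..b} = {t \<in> {a..b}. oce.f t = v}" "{t \<in> {a..b}. oce.f t = v} \<noteq> {}"
    using oce_value_attained[OF f_cont \<open>a \<le> b\<close> oce.oce_objective_eq] by metis
  have S: "S = {t \<in> {a..b}. oce.f t = v}" "S \<noteq> {}"
    using v(3,4) \<open>S = _\<close> \<open>T = {a..b}\<close> by simp_all
  have "closed {t \<in> {a..b}. oce.f t = v}"
    using f_cont by (rule continuous_closed_preimage_constant) simp
  moreover have "bounded S"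
    by (rule bounded_subset[OF bounded_closed_interval[of a b]]) (use S(1) in blast)
  ultimately have comp: "compact S" using S(1) by (simp add: compact_eq_bounded_closed)
  have "convex S"
    unfolding convex_alt
  proof (intro ballI allI impI, elim conjE)
    fix s t w :: real assume st: "s \<in> S" "t \<in> S" and w: "0 \<le> w" "w \<le> 1"
    then have st': "s \<in> {a..b}" "t \<in> {a..b}" "oce.f s = v" "oce.f t = v" using S(1) by auto
    have r: "(1 - w) * s + w * t \<in> {a..b}"
      using convexD_alt[OF convex_real_interval(5) st'(1,2) w] by simp
    have "oce.f ((1 - w) * s + w * t) \<le> v"
      using oce.f_convex[OF st'(1,2) w] st'(3,4) by (simp add: algebra_simps)
    then show "(1 - w) *\<^sub>R s + w *\<^sub>R t \<in> S" using v(2)[OF r] r S(1) by simp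
  qed
  then have "connected S \<and> compact S" using comp convex_connected by blast
  then obtain tl tu where tltu: "S = {tl..tu}" using connected_compact_interval_1 by blast
  define Z where "Z n \<omega> = sqrt (real n) *
      (real_of_ereal (saa_value l n (\<lambda>i. X i \<omega>) T) - real_of_ereal (oce_value l P \<xi> T))" for n \<omega>
  have Z_meas: "Z n \<in> borel_measurable M" for n
    using saa_value_measurable[OF oce.l_mono oce.l_measurable \<open>a \<le> b\<close>, of X M n] smp.X_measurable
    unfolding Z_def[abs_def] \<open>T = {a..b}\<close> by simp
  have Z_eq: "AE \<omega> in M. Z n \<omega> = sqrt n * ((INF t\<in>{a..b}. oce.f t + smp.G n t \<omega> / sqrt n) - v)"
    if n: "0 < n" for n :: nat
    using smp.AE_sample[OF oce.AE_law_finite]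
  proof eventually_elim
    case (elim \<omega>)
    let ?\<phi> = "\<lambda>t. oce.f t + smp.G n t \<omega> / sqrt n"
    have obj: "saa_objective l n (\<lambda>i. X i \<omega>) t = ereal (?\<phi> t)" if t: "t \<in> {a..b}" for t
    proof -
      have "saa_objective l n (\<lambda>i. X i \<omega>) t = ereal (t + 1 / n * (\<Sum>i<n. oce.h t (X i \<omega>)))"
        unfolding saa_objective_def using oce.loss_eq_h[OF _ t] elim by simp
      also have "t + 1 / n * (\<Sum>i<n. oce.h t (X i \<omega>)) = ?\<phi> t"
        unfolding f_eq smp.G_def smp.normalized_sum_def smp.centered_def
        using n by (simp add: sum_subtractf diff_divide_distrib)
      finally show ?thesis .
    qed
    \<comment> \<open>The bound \<open>l z \<ge> z\<close> keeps the sample objective away from \<open>-\<infinity>\<close> on \<open>[a, b]\<close>.\<close>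
    have "bdd_below (?\<phi> ` {a..b})"
    proof (rule bdd_belowI2)
      fix t assume t: "t \<in> {a..b}"
      have "ereal (a + 1 / n * (\<Sum>i<n. X i \<omega> - b)) \<le> saa_objective l n (\<lambda>i. X i \<omega>) t"
      proof -
        have "ereal (X i \<omega> - b) \<le> l (X i \<omega> - t)" for i
          using loss_of_ge[OF assms(1), of "X i \<omega> - t"] t unfolding \<open>l = _\<close>
          by (elim order_trans[rotated]) simp
        then have "ereal a + ereal (1 / n) * (\<Sum>i<n. ereal (X i \<omega> - b)) \<le> saa_objective l n (\<lambda>i. X i \<omega>) t"
          unfolding saa_objective_def using t by (intro add_mono ereal_mult_left_mono sum_mono) auto
        then show ?thesis by simp
      qed
      then show "a + 1 / n * (\<Sum>i<n. X i \<omega> - b) \<le> ?\<phi> t" unfolding obj[OF t] by simp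
    qed
    then have "ereal (INF t\<in>{a..b}. ?\<phi> t) = (INF t\<in>{a..b}. ereal (?\<phi> t))"
      using ereal_Inf'[of "?\<phi> ` {a..b}"] \<open>a \<le> b\<close> by (simp add: image_comp comp_def)
    also have "\<dots> = saa_value l n (\<lambda>i. X i \<omega>) T"
      unfolding saa_value_def \<open>T = {a..b}\<close> by (intro INF_cong refl obj[symmetric])
    finally have "real_of_ereal (saa_value l n (\<lambda>i. X i \<omega>) T) = (INF t\<in>{a..b}. ?\<phi> t)"
      by (metis real_of_ereal.simps(1))
    then show ?case unfolding Z_def using v(1) \<open>T = {a..b}\<close> by simp
  qed
  have cov: "loss_covariance l P \<xi> = (\<lambda>s t. \<integral>x. smp.centered s x * smp.centered t x \<partial>oce.\<mu>)"
    unfolding oce.loss_covariance_eq smp.centered_def smp.mean_def ..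
  have var: "loss_variance l P \<xi> t = (\<integral>x. (smp.centered t x)\<^sup>2 \<partial>oce.\<mu>)" for t
    unfolding oce.loss_variance_eq smp.centered_def smp.mean_def ..
  have "weak_conv_m (\<lambda>n. distr M borel (Z n)) (distr N borel (\<lambda>\<omega>. INF t\<in>{tl..tu}. Y t \<omega>))"
    if "centered_gaussian_process N T (loss_covariance l P \<xi>) Y" for N :: "'c measure" and Y
    using smp.scaled_gap_weak_limit[OF f_cont v(2) Z_meas Z_eq S(1) comp S(2)] that
    unfolding cov \<open>T = {a..b}\<close> tltu by blast
  moreover have "weak_conv_m (\<lambda>n. distr M borel (Z n)) (normal_law 0 (loss_variance l P \<xi> t0))"
    if "S = {t0}" for t0
    unfolding var
    by (rule smp.scaled_gap_weak_limit_singleton[OF f_cont v(2) Z_meas Z_eq]) (use that S(1) in auto)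
  moreover have "tl \<le> tu" using S(2) tltu by simp
  ultimately show ?thesis unfolding Z_def[abs_def] using tltu by blast
qed

end
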